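(* Let $p=p(n)$, $m=\binom n2 p$ and $d=(n-2)p^2$, and suppose $d=\Theta(1)$, i.e. there are constants $0<c\le C$ with $c\le d\le C$ for all sufficiently large $n$. Let $\xi(d)=\frac13\big[1-(2d+1)^{-1/2}\big]$. Then for every $\varepsilon>0$, with probability tending to $1$ as $n\to\infty$, \[\nu(G_{n,p})>(1-\varepsilon)\,\xi(d)\,m.\]
   Context: $G_{n,p}$ is the binomial random graph on vertex set $[n]$ in which each of the $\binom n2$ possible edges is present independently with probability $p$. For a finite graph $H$, $\nu(H)$ is the maximum number of pairwise edge-disjoint triangles in $H$. *)

theory Defs
  imports "HOL-Probability.Probability" "HOL-Library.Ramsey"
begin

text \<open>
  A graph is given by its set of edges, each edge being a two-element set of vertices; the vertex
  set is left implicit, since isolated vertices affect neither triangles nor their packings.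
  From \<open>HOL-Library.Ramsey\<close>, \<open>[A]\<^bsup>k\<^esup>\<close> is the set of \<open>k\<close>-element subsets of \<open>A\<close>.
\<close>

definition triangles :: "'a set set \<Rightarrow> 'a set set" where
  "triangles E = {T. card T = 3 \<and> [T]\<^bsup>2\<^esup> \<subseteq> E}"

definition triangle_packing :: "'a set set \<Rightarrow> 'a set set \<Rightarrow> bool" where
  "triangle_packing E F \<longleftrightarrow>
     F \<subseteq> triangles E \<and> pairwise (\<lambda>S T. disjnt ([S]\<^bsup>2\<^esup>) ([T]\<^bsup>2\<^esup>)) F"

text \<open>Meaningful for finite \<open>E\<close>, where the set of packing sizes is finite.\<close>

definition nu :: "'a set set \<Rightarrow> nat" where
  "nu E = Max {card F |F. triangle_packing E F}"

definition random_graph :: "nat \<Rightarrow> real \<Rightarrow> nat set set pmf" where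
  "random_graph n p =
     map_pmf (\<lambda>present. {e \<in> [{1..n}]\<^bsup>2\<^esup>. present e})
       (Pi_pmf ([{1..n}]\<^bsup>2\<^esup>) False (\<lambda>_. bernoulli_pmf p))"

definition xi :: "real \<Rightarrow> real" where
  "xi d = 1 / 3 * (1 - (2 * d + 1) powr (- 1 / 2))"

end

theory Submission
  imports Defs
begin

text \<open>
  Fix a large constant \<open>K\<close> and put a triangle into the class (sum of its three vertices) mod \<open>K\<close>. In
  round \<open>i = 0, \<dots>, K - 1\<close> every edge of every class-\<open>i\<close> triangle all of whose edges are still alive is
  killed. The triangles used, apart from those sharing an edge with another triangle used in the
  same round, form a packing, and only an \<open>O(1/K)\<close> fraction is lost in this way. An edge lies in
  about Poisson(\<open>d/K\<close>) triangles of each class, so it should survive \<open>i\<close> rounds with probability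
  \<open>q\<^sub>i\<close>, where \<open>q\<^sub>i\<^sub>+\<^sub>1 = q\<^sub>i exp(- (d/K) q\<^sub>i\<^sup>2)\<close>; then \<open>1/q\<^sub>i\<^sup>2\<close> grows by at least \<open>2d/K\<close> in each round,
  whence \<open>q\<^sub>K \<le> (2d + 1)\<^bsup>-1/2\<^esup>\<close>.

  To make this rigorous, a bounded set \<open>J\<close> of edges is planted in the random graph and one shows,
  uniformly in \<open>J\<close>, that the joint survival probabilities of edges of \<open>J\<close> are asymptotically
  products of the \<open>q\<^sub>i\<close>. In the induction a single edge \<open>e\<close> is moved from round \<open>i\<close> to \<open>i + 1\<close>: the event
  that no triangle kills it is expanded by Bonferroni's inequalities into events that prescribed
  class-\<open>i\<close> triangles on \<open>e\<close> are present and alive, and conditioning on their presence just plants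
  their edges as well. Planting two edges gives the second moment of the number of killed edges.
\<close>

section \<open>Random subsets and planted elements\<close>

text \<open>Over an arbitrary ground set a single element can be split off and exposed on its
  own.\<close>

definition random_subset :: "'a set \<Rightarrow> real \<Rightarrow> 'a set pmf" where
  "random_subset A p = map_pmf (\<lambda>f. {x \<in> A. f x}) (Pi_pmf A False (\<lambda>_. bernoulli_pmf p))"

lemma random_graph_eq_random_subset: "random_graph n p = random_subset ([{1..n}]\<^bsup>2\<^esup>) p"
  by (simp add: random_graph_def random_subset_def)

lemma set_pmf_random_subset: "set_pmf (random_subset A p) \<subseteq> Pow A"
  by (auto simp: random_subset_def)

lemma finite_set_pmf_random_subset: "finite A \<Longrightarrow> finite (set_pmf (random_subset A p))"
  using set_pmf_random_subset[of A p] by (simp add: finite_subset)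

lemma integrable_random_subset [simp]:
  fixes f :: "'a set \<Rightarrow> real"
  shows "finite A \<Longrightarrow> integrable (measure_pmf (random_subset A p)) f"
  by (simp add: integrable_measure_pmf_finite finite_set_pmf_random_subset)

lemma expectation_random_subset_mono:
  fixes f g :: "'a set \<Rightarrow> real"
  assumes "finite A" "\<And>G. G \<subseteq> A \<Longrightarrow> f G \<le> g G"
  shows "measure_pmf.expectation (random_subset A p) f \<le> measure_pmf.expectation (random_subset A p) g"
  using assms set_pmf_random_subset[of A p]
  by (intro integral_mono_AE) (auto simp: AE_measure_pmf_iff)

lemma expectation_random_subset_cong:
  fixes f g :: "'a set \<Rightarrow> real"
  assumes "\<And>G. G \<subseteq> A \<Longrightarrow> f G = g G"
  shows "measure_pmf.expectation (random_subset A p) f = measure_pmf.expectation (random_subset A p) g"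
  using assms set_pmf_random_subset[of A p]
  by (intro integral_cong_AE) (auto simp: AE_measure_pmf_iff)

lemma random_subset_insert:
  assumes "finite A" "x \<notin> A"
  shows "random_subset (insert x A) p =
    bernoulli_pmf p \<bind> (\<lambda>b. map_pmf (\<lambda>G. if b then insert x G else G) (random_subset A p))"
proof -
  have "{y \<in> insert x A. (f(x := b)) y} = (if b then insert x {y \<in> A. f y} else {y \<in> A. f y})" for b f
    using assms by auto
  then show ?thesis
    unfolding random_subset_def Pi_pmf_insert[OF assms] pair_pmf_def
    by (simp add: map_bind_pmf map_pmf_def bind_assoc_pmf bind_return_pmf del: fun_upd_apply)
qed

lemma expectation_random_subset_insert:
  fixes f :: "'a set \<Rightarrow> real"
  assumes "finite A" "x \<notin> A" "0 \<le> p" "p \<le> 1"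
  shows "measure_pmf.expectation (random_subset (insert x A) p) f =
    p * measure_pmf.expectation (random_subset A p) (\<lambda>G. f (insert x G)) +
    (1 - p) * measure_pmf.expectation (random_subset A p) f"
  using assms unfolding random_subset_insert[OF assms(1,2)]
  by (subst pmf_expectation_bind[of UNIV]) (auto simp: UNIV_bool finite_set_pmf_random_subset)

text \<open>Expose \<open>x\<close> apart from the rest: the factor
  \<open>of_bool (x \<in> G)\<close> leaves only the branch of weight \<open>p\<close>, and
  \<open>f (insert x G)\<close> is blind to whether \<open>x\<close> was drawn.\<close>

lemma expectation_random_subset_plant1:
  fixes f :: "'a set \<Rightarrow> real"
  assumes "finite A" "x \<in> A" "0 \<le> p" "p \<le> 1"
  shows "measure_pmf.expectation (random_subset A p) (\<lambda>G. of_bool (x \<in> G) * f G) =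
    p * measure_pmf.expectation (random_subset A p) (\<lambda>G. f (insert x G))"
proof -
  define B where "B = A - {x}"
  have B: "A = insert x B" "x \<notin> B" "finite B" using assms by (auto simp: B_def)
  have "measure_pmf.expectation (random_subset B p) (\<lambda>G. of_bool (x \<in> G) * f G) =
      measure_pmf.expectation (random_subset B p) (\<lambda>G. 0)"
    using B by (intro expectation_random_subset_cong) auto
  then show ?thesis
    unfolding B(1) using B assms by (simp add: expectation_random_subset_insert algebra_simps)
qed

text \<open>Given \<open>J \<subseteq> G\<close>, the set \<open>G\<close> is distributed like an
  unconditioned sample with \<open>J\<close> added. The product form says this without conditional
  probabilities, hence also for \<open>p = 0\<close>.\<close>

lemma expectation_random_subset_plant:
  fixes f :: "'a set \<Rightarrow> real"
  assumes "finite A" "J \<subseteq> A" "0 \<le> p" "p \<le> 1"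
  shows "measure_pmf.expectation (random_subset A p) (\<lambda>G. of_bool (J \<subseteq> G) * f G) =
    p ^ card J * measure_pmf.expectation (random_subset A p) (\<lambda>G. f (G \<union> J))"
proof -
  have "finite J" using assms finite_subset by blast
  then show ?thesis using assms(2)
  proof (induction J arbitrary: f)
    case empty
    then show ?case by simp
  next
    case (insert x J)
    have "measure_pmf.expectation (random_subset A p) (\<lambda>G. of_bool (insert x J \<subseteq> G) * f G) =
      measure_pmf.expectation (random_subset A p) (\<lambda>G. of_bool (x \<in> G) * (of_bool (J \<subseteq> G) * f G))"
      by (intro expectation_random_subset_cong) auto
    also have "\<dots> = p * measure_pmf.expectation (random_subset A p) (\<lambda>G. of_bool (J \<subseteq> insert x G) * f (insert x G))"
      using insert assms by (subst expectation_random_subset_plant1) auto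
    also have "\<dots> = p * measure_pmf.expectation (random_subset A p) (\<lambda>G. of_bool (J \<subseteq> G) * f (insert x G))"
      using insert by (simp add: subset_insert)
    also have "\<dots> = p ^ card (insert x J) * measure_pmf.expectation (random_subset A p) (\<lambda>G. f (G \<union> insert x J))"
      using insert by simp
    finally show ?case .
  qed
qed

text \<open>For \<open>N = Suc M\<close> the alternating sum telescopes to
  \<open>(-1) ^ r * (M choose r)\<close>, and \<open>M choose r\<close> is at most
  \<open>N choose Suc r\<close> by Pascal's rule. The absolute value treats both parities of
  \<open>r\<close> at once.\<close>

lemma bonferroni_choose:
  "\<bar>of_bool (N = 0) - (\<Sum>k\<le>r. (-1) ^ k * real (N choose k))\<bar> \<le> real (N choose Suc r)"
proof (cases N)
  case 0
  have "(\<Sum>k\<le>r. (-1) ^ k * real (0 choose k)) = (\<Sum>k\<in>{0}. (-1) ^ k * real (0 choose k))"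
    by (rule sum.mono_neutral_right) (auto simp: binomial_eq_0)
  then show ?thesis using 0 by simp
next
  case (Suc M)
  have *: "(\<Sum>k\<le>r. (-1) ^ k * real (Suc M choose k)) = (-1) ^ r * real (M choose r)"
    by (induction r) (auto simp: algebra_simps)
  have "(M choose r) \<le> (Suc M choose Suc r)" by simp
  then show ?thesis using * Suc by (simp add: abs_mult)
qed

text \<open>Turns binomial moments of a random set \<open>S\<close> into sums over events
  \<open>R \<subseteq> S\<close>, which can be treated by planting.\<close>

lemma real_card_choose_eq_sum:
  assumes "finite W" "S \<subseteq> W"
  shows "real (card S choose k) = (\<Sum>R\<in>[W]\<^bsup>k\<^esup>. of_bool (R \<subseteq> S))"
proof -
  have "real (card S choose k) = real (card {R. R \<subseteq> S \<and> card R = k})"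
    using assms by (simp add: n_subsets finite_subset)
  also have "{R. R \<subseteq> S \<and> card R = k} = {R \<in> [W]\<^bsup>k\<^esup>. R \<subseteq> S}"
    using assms by (auto simp: nsets_def intro: finite_subset)
  also have "real (card \<dots>) = (\<Sum>R\<in>[W]\<^bsup>k\<^esup>. of_bool (R \<subseteq> S))"
    using assms by (simp add: finite_imp_finite_nsets Int_def)
  finally show ?thesis .
qed

section \<open>Killing edges in rounds\<close>

text \<open>For \<open>w\<close> outside an edge \<open>e\<close>, these are the other two edges of
  the triangle with base \<open>e\<close> and apex \<open>w\<close>.\<close>

definition spokes :: "'a \<Rightarrow> 'a set \<Rightarrow> 'a set set" where
  "spokes w e = (\<lambda>x. {w, x}) ` e"

text \<open>For \<open>w \<notin> e\<close> the class of the triangle \<open>insert w e\<close> is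
  \<open>(w + \<Sum>e) mod K\<close>. Only the spokes must lie in \<open>G\<close>: a pair
  \<open>e\<close> can be alive whether it is present or not, so that its presence can be handled
  separately.\<close>

primrec alive :: "nat \<Rightarrow> nat \<Rightarrow> nat set set \<Rightarrow> nat \<Rightarrow> nat set \<Rightarrow> bool" where
  "alive n K G 0 e \<longleftrightarrow> True"
| "alive n K G (Suc i) e \<longleftrightarrow> alive n K G i e \<and>
     (\<forall>w\<in>{1..n} - e. (w + \<Sum>e) mod K = i \<longrightarrow> \<not> (\<forall>f\<in>spokes w e. f \<in> G \<and> alive n K G i f))"

text \<open>The edges in \<open>L1\<close> have already been advanced to round \<open>i + 1\<close>, those in \<open>L2\<close> not yet.\<close>

definition alive_prob :: "nat \<Rightarrow> real \<Rightarrow> nat \<Rightarrow> nat set set \<Rightarrow> nat \<Rightarrow> nat set set \<Rightarrow> nat set set \<Rightarrow> real" where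
  "alive_prob n p K J i L1 L2 = measure_pmf.expectation (random_graph n p)
     (\<lambda>G. of_bool ((\<forall>f\<in>L1. alive n K (G \<union> J) (Suc i) f) \<and> (\<forall>f\<in>L2. alive n K (G \<union> J) i f)))"

text \<open>
  A triangle that is completely contained in the planted set \<open>J\<close> and has a class below \<open>i\<close> could kill \<open>f\<close>
  before round \<open>i\<close> with probability of constant order; \<open>late\<close> rules this out.
\<close>

definition late :: "nat \<Rightarrow> nat set set \<Rightarrow> nat \<Rightarrow> nat set \<Rightarrow> bool" where
  "late K J i f \<longleftrightarrow> (\<forall>w. w \<notin> f \<longrightarrow> spokes w f \<subseteq> J \<longrightarrow> i \<le> (w + \<Sum>f) mod K)"

declare finite_imp_finite_nsets [simp]

lemma alive_prob_le_1: "alive_prob n p K J i L1 L2 \<le> 1"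
proof -
  have "alive_prob n p K J i L1 L2 \<le> measure_pmf.expectation (random_graph n p) (\<lambda>_. 1)"
    unfolding alive_prob_def random_graph_eq_random_subset
    by (rule expectation_random_subset_mono) auto
  then show ?thesis by simp
qed

lemma UN_spokes: "(\<Union>w\<in>R. spokes w e) = (\<lambda>(w, x). {w, x}) ` (R \<times> e)"
  by (auto simp: spokes_def)

lemma card_UN_spokes:
  assumes "R \<inter> e = {}" "card e = 2"
  shows "card (\<Union>w\<in>R. spokes w e) = 2 * card R"
proof -
  have "inj_on (\<lambda>(w, x). {w, x}) (R \<times> e)"
    using assms by (auto simp: inj_on_def doubleton_eq_iff)
  then show ?thesis using assms by (simp add: UN_spokes card_image card_cartesian_product)
qed

lemma finite_spokes: "finite e \<Longrightarrow> finite (spokes w e)"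
  by (simp add: spokes_def)

lemma UN_spokes_subset_pairs:
  assumes "R \<inter> e = {}" "R \<subseteq> {1..n}" "e \<in> [{1..n}]\<^bsup>2\<^esup>"
  shows "(\<Union>w\<in>R. spokes w e) \<subseteq> [{1..n}]\<^bsup>2\<^esup>"
  using assms by (auto simp: UN_spokes nsets_def card_2_iff)

lemma spokes_Int_outside: "w \<notin> \<Union>J \<Longrightarrow> spokes w e \<inter> J = {}"
  by (auto simp: spokes_def)

text \<open>
  The error terms stem from, in this order, the assumption on the planted triangles, the Bonferroni
  truncation, and apexes of killing triangles among the vertices of \<open>J\<close> itself.
\<close>

lemma alive_prob_step:
  fixes n i r K :: nat and p \<theta> x \<delta> :: real and J L1 L2 :: "nat set set" and e :: "nat set"
  defines "W \<equiv> {w \<in> {1..n} - \<Union>J. (w + \<Sum>e) mod K = i}"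
  assumes p: "0 \<le> p" "p \<le> 1"
    and J: "J \<subseteq> [{1..n}]\<^bsup>2\<^esup>" and e: "e \<in> J"
    and late: "late K J (Suc i) e"
    and bound: "\<And>R. R \<subseteq> W \<Longrightarrow> card R \<le> r \<Longrightarrow>
      \<bar>alive_prob n p K (J \<union> (\<Union>w\<in>R. spokes w e)) i L1 (insert e L2 \<union> (\<Union>w\<in>R. spokes w e))
        - \<theta> * x ^ card R\<bar> \<le> \<delta>"
  shows "\<bar>alive_prob n p K J i (insert e L1) L2
      - \<theta> * (\<Sum>k\<le>r. (-1) ^ k * (real (card W choose k) * p ^ (2 * k)) * x ^ k)\<bar>
    \<le> \<delta> * (\<Sum>k\<le>r. real (card W choose k) * p ^ (2 * k))
      + real (card W choose Suc r) * p ^ (2 * Suc r) + real (card (\<Union>J)) * p"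
proof -
  let ?P = "[{1..n}]\<^bsup>2\<^esup>"
  let ?E = "measure_pmf.expectation (random_graph n p) :: (nat set set \<Rightarrow> real) \<Rightarrow> real"
  let ?SP = "\<lambda>R. \<Union>w\<in>R. spokes w e"
  define V where "V = \<Union>J"
  \<comment> \<open>\<open>S\<close> collects the apexes outside \<open>V\<close> whose triangle
    kills \<open>e\<close> in round \<open>i\<close>. \<open>A\<close> is the event before
    \<open>e\<close> is advanced, \<open>X\<close> the one after. \<open>B\<close> will be used for
    apexes in \<open>V\<close>.\<close>
  define S where "S G = {w \<in> W. spokes w e \<subseteq> G \<and> (\<forall>f\<in>spokes w e. alive n K (G \<union> J) i f)}" for G
  define A where "A G \<longleftrightarrow> (\<forall>f\<in>L1. alive n K (G \<union> J) (Suc i) f) \<and> (\<forall>f\<in>insert e L2. alive n K (G \<union> J) i f)" for G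
  define X where "X G \<longleftrightarrow> (\<forall>f\<in>insert e L1. alive n K (G \<union> J) (Suc i) f) \<and> (\<forall>f\<in>L2. alive n K (G \<union> J) i f)" for G
  define B where "B w G \<longleftrightarrow> w \<notin> e \<and> (w + \<Sum>e) mod K = i \<and> spokes w e \<subseteq> G \<union> J" for w G
  have int: "integrable (measure_pmf (random_graph n p)) f" for f :: "nat set set \<Rightarrow> real"
    by (simp add: random_graph_eq_random_subset)
  have mono: "?E f \<le> ?E g" if "\<And>G. G \<subseteq> ?P \<Longrightarrow> f G \<le> g G" for f g :: "nat set set \<Rightarrow> real"
    unfolding random_graph_eq_random_subset using that by (intro expectation_random_subset_mono) auto
  have abs_le: "\<bar>?E f - ?E g\<bar> \<le> ?E h" if "\<And>G. G \<subseteq> ?P \<Longrightarrow> \<bar>f G - g G\<bar> \<le> h G" for f g h :: "nat set set \<Rightarrow> real"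
  proof -
    have "?E f - ?E g = ?E (\<lambda>G. f G - g G)" by (simp add: int)
    also have "\<bar>\<dots>\<bar> \<le> ?E (\<lambda>G. \<bar>f G - g G\<bar>)" by (rule integral_abs_bound)
    also have "\<dots> \<le> ?E h" using that by (rule mono)
    finally show ?thesis .
  qed
  have eP: "e \<in> ?P" and eV: "e \<subseteq> V" using e J by (auto simp: V_def)
  have e2: "card e = 2" and fe: "finite e" using eP by (auto simp: nsets_def)
  have V: "V \<subseteq> {1..n}" using J by (auto simp: V_def nsets_def)
  have fV: "finite V" using V finite_subset by blast
  have fW: "finite W" by (simp add: W_def)
  have We: "W \<inter> V = {}" "W \<subseteq> {1..n}" by (auto simp: W_def V_def)
  have SW: "S G \<subseteq> W" for G by (auto simp: S_def)
  \<comment> \<open>Unless a vertex of \<open>J\<close> is the apex of a class-\<open>i\<close>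
    triangle on \<open>e\<close>, the event \<open>X\<close> says that \<open>A\<close> holds and
    \<open>S G\<close> is empty: spokes to an apex outside \<open>V\<close> are not planted and must
    come from \<open>G\<close>.\<close>
  have approx: "\<bar>of_bool (X G) - of_bool (A G) * of_bool (card (S G) = 0)\<bar> \<le> (\<Sum>w\<in>V. of_bool (B w G) :: real)" for G
  proof (cases "\<exists>w\<in>V. B w G")
    case True
    then have "1 \<le> (\<Sum>w\<in>V. of_bool (B w G) :: real)"
      using fV member_le_sum[of _ V "\<lambda>w. of_bool (B w G) :: real"] by fastforce
    then show ?thesis by (simp split: split_of_bool)
  next
    case False
    have S0: "card (S G) = 0 \<longleftrightarrow> S G = {}" using fW SW finite_subset by (metis card_eq_0_iff)
    have "X G \<longleftrightarrow> A G \<and> S G = {}"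
    proof
      assume X: "X G"
      have "S G = {}"
      proof (rule ccontr)
        assume "S G \<noteq> {}"
        then obtain w where w: "w \<in> S G" by blast
        then have "w \<in> {1..n} - e" "(w + \<Sum>e) mod K = i" using eV We by (auto simp: S_def W_def V_def)
        moreover have "\<forall>f\<in>spokes w e. f \<in> G \<union> J \<and> alive n K (G \<union> J) i f" using w by (auto simp: S_def)
        ultimately show False using X by (auto simp: X_def)
      qed
      with X show "A G \<and> S G = {}" by (auto simp: X_def A_def)
    next
      assume *: "A G \<and> S G = {}"
      have "alive n K (G \<union> J) (Suc i) e"
        unfolding alive.simps(2)
      proof (intro conjI ballI impI)
        show "alive n K (G \<union> J) i e" using * by (auto simp: A_def)
        fix w assume w: "w \<in> {1..n} - e" "(w + \<Sum>e) mod K = i"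
        show "\<not> (\<forall>f\<in>spokes w e. f \<in> G \<union> J \<and> alive n K (G \<union> J) i f)"
        proof (cases "w \<in> V")
          case True
          then show ?thesis using False w by (auto simp: B_def)
        next
          case False
          then have wW: "w \<in> W" using w by (auto simp: W_def V_def)
          have "spokes w e \<inter> J = {}" using False by (intro spokes_Int_outside) (auto simp: V_def)
          moreover have "\<not> (spokes w e \<subseteq> G \<and> (\<forall>f\<in>spokes w e. alive n K (G \<union> J) i f))"
            using wW * by (auto simp: S_def)
          ultimately show ?thesis by blast
        qed
      qed
      then show "X G" using * by (auto simp: X_def A_def)
    qed
    then show ?thesis using S0 by (auto intro!: sum_nonneg)
  qed
  have EB: "?E (\<lambda>G. of_bool (B w G)) \<le> p" if "w \<in> V" for w
  proof (cases "w \<notin> e \<and> (w + \<Sum>e) mod K = i")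
    case True
    \<comment> \<open>The class \<open>i\<close> is below \<open>Suc i\<close>, so lateness forbids
      that both spokes are planted; a missing one must be drawn, with probability
      \<open>p\<close>.\<close>
    then have "\<not> spokes w e \<subseteq> J" using late by (auto simp: late_def)
    then obtain s where s: "s \<in> spokes w e" "s \<notin> J" by blast
    have sP: "s \<in> ?P" using UN_spokes_subset_pairs[of "{w}" e n] subsetD[OF V that] True eP s by auto
    have "?E (\<lambda>G. of_bool (B w G)) \<le> ?E (\<lambda>G. of_bool ({s} \<subseteq> G) * 1)"
      by (rule mono) (use s in \<open>auto simp: B_def\<close>)
    also have "\<dots> = p" unfolding random_graph_eq_random_subset
      using p sP by (subst expectation_random_subset_plant) auto
    finally show ?thesis .
  next
    case False
    then have "B w G = False" for G by (auto simp: B_def)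
    then show ?thesis using p by simp
  qed
  have E1: "\<bar>?E (\<lambda>G. of_bool (X G)) - ?E (\<lambda>G. of_bool (A G) * of_bool (card (S G) = 0))\<bar> \<le> real (card V) * p"
  proof -
    have "\<bar>?E (\<lambda>G. of_bool (X G)) - ?E (\<lambda>G. of_bool (A G) * of_bool (card (S G) = 0))\<bar> \<le> ?E (\<lambda>G. \<Sum>w\<in>V. of_bool (B w G))"
      by (rule abs_le) (rule approx)
    also have "\<dots> = (\<Sum>w\<in>V. ?E (\<lambda>G. of_bool (B w G)))" by (simp add: int)
    also have "\<dots> \<le> real (card V) * p" using EB by (rule sum_bounded_above)
    finally show ?thesis .
  qed
  \<comment> \<open>Prescribing \<open>R \<subseteq> S G\<close> demands the presence of
    \<open>2 * k\<close> edges, which are planted at cost \<open>p ^ (2 * k)\<close>, and their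
    survival, which adds them to the edges still at round \<open>i\<close>.\<close>
  have moment: "?E (\<lambda>G. of_bool (A G) * real (card (S G) choose k)) =
     (\<Sum>R\<in>[W]\<^bsup>k\<^esup>. p ^ (2 * k) * alive_prob n p K (J \<union> ?SP R) i L1 (insert e L2 \<union> ?SP R))" for k
  proof -
    have "?E (\<lambda>G. of_bool (A G) * real (card (S G) choose k)) =
      (\<Sum>R\<in>[W]\<^bsup>k\<^esup>. ?E (\<lambda>G. of_bool (A G) * of_bool (R \<subseteq> S G)))"
      by (simp add: real_card_choose_eq_sum[OF fW SW] sum_distrib_left int)
    also have "\<dots> = (\<Sum>R\<in>[W]\<^bsup>k\<^esup>. p ^ (2 * k) * alive_prob n p K (J \<union> ?SP R) i L1 (insert e L2 \<union> ?SP R))"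
    proof (rule sum.cong[OF refl])
      fix R assume "R \<in> [W]\<^bsup>k\<^esup>"
      then have R: "R \<subseteq> W" "card R = k" by (auto simp: nsets_def)
      have Re: "R \<inter> e = {}" using R We eV by auto
      have RP: "?SP R \<subseteq> ?P" using UN_spokes_subset_pairs[OF Re _ eP] R We by auto
      define g where "g H \<longleftrightarrow> (\<forall>f\<in>L1. alive n K (H \<union> J) (Suc i) f) \<and> (\<forall>f\<in>insert e L2 \<union> ?SP R. alive n K (H \<union> J) i f)" for H
      have "?E (\<lambda>G. of_bool (A G) * of_bool (R \<subseteq> S G)) = ?E (\<lambda>G. of_bool (?SP R \<subseteq> G) * of_bool (g G))"
        by (rule arg_cong[where f = ?E], rule ext) (use R in \<open>auto simp: A_def S_def g_def\<close>)
      also have "\<dots> = p ^ card (?SP R) * ?E (\<lambda>G. of_bool (g (G \<union> ?SP R)))"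
        unfolding random_graph_eq_random_subset using RP p
        by (subst expectation_random_subset_plant) auto
      also have "card (?SP R) = 2 * k" using card_UN_spokes[OF Re e2] R by simp
      also have "?E (\<lambda>G. of_bool (g (G \<union> ?SP R))) = alive_prob n p K (J \<union> ?SP R) i L1 (insert e L2 \<union> ?SP R)"
      proof -
        have "G \<union> ?SP R \<union> J = G \<union> (J \<union> ?SP R)" for G by blast
        then show ?thesis unfolding alive_prob_def g_def by simp
      qed
      finally show "?E (\<lambda>G. of_bool (A G) * of_bool (R \<subseteq> S G)) = p ^ (2 * k) * alive_prob n p K (J \<union> ?SP R) i L1 (insert e L2 \<union> ?SP R)" .
    qed
    finally show ?thesis .
  qed
  \<comment> \<open>Bonferroni's inequality is applied pointwise on the event \<open>A\<close>; in
    the remainder every survival probability is estimated by 1.\<close>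
  have E2: "\<bar>?E (\<lambda>G. of_bool (A G) * of_bool (card (S G) = 0))
      - (\<Sum>k\<le>r. (-1) ^ k * ?E (\<lambda>G. of_bool (A G) * real (card (S G) choose k)))\<bar>
      \<le> real (card W choose Suc r) * p ^ (2 * Suc r)"
  proof -
    have "(\<Sum>k\<le>r. (-1) ^ k * ?E (\<lambda>G. of_bool (A G) * real (card (S G) choose k)))
      = ?E (\<lambda>G. \<Sum>k\<le>r. (-1) ^ k * (of_bool (A G) * real (card (S G) choose k)))"
      by (simp add: int)
    then have "\<bar>?E (\<lambda>G. of_bool (A G) * of_bool (card (S G) = 0))
      - (\<Sum>k\<le>r. (-1) ^ k * ?E (\<lambda>G. of_bool (A G) * real (card (S G) choose k)))\<bar>
      \<le> ?E (\<lambda>G. of_bool (A G) * real (card (S G) choose Suc r))"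
    proof (simp only:, intro abs_le)
      fix G
      show "\<bar>of_bool (A G) * of_bool (card (S G) = 0) - (\<Sum>k\<le>r. (-1) ^ k * (of_bool (A G) * real (card (S G) choose k)))\<bar>
        \<le> of_bool (A G) * real (card (S G) choose Suc r)"
        using bonferroni_choose[of "card (S G)" r] by (cases "A G") simp_all
    qed
    also have "\<dots> \<le> (\<Sum>R\<in>[W]\<^bsup>Suc r\<^esup>. p ^ (2 * Suc r) * 1)"
      unfolding moment using p by (intro sum_mono mult_left_mono alive_prob_le_1) auto
    also have "\<dots> = real (card W choose Suc r) * p ^ (2 * Suc r)" by simp
    finally show ?thesis .
  qed
  have E3: "\<bar>(\<Sum>k\<le>r. (-1) ^ k * ?E (\<lambda>G. of_bool (A G) * real (card (S G) choose k)))
     - \<theta> * (\<Sum>k\<le>r. (-1) ^ k * (real (card W choose k) * p ^ (2 * k)) * x ^ k)\<bar>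
     \<le> \<delta> * (\<Sum>k\<le>r. real (card W choose k) * p ^ (2 * k))"
  proof -
    have "\<bar>(\<Sum>k\<le>r. (-1) ^ k * ?E (\<lambda>G. of_bool (A G) * real (card (S G) choose k)))
       - \<theta> * (\<Sum>k\<le>r. (-1) ^ k * (real (card W choose k) * p ^ (2 * k)) * x ^ k)\<bar>
      = \<bar>\<Sum>k\<le>r. (-1) ^ k * (?E (\<lambda>G. of_bool (A G) * real (card (S G) choose k)) - real (card W choose k) * p ^ (2 * k) * (\<theta> * x ^ k))\<bar>"
    proof -
      have "\<theta> * (\<Sum>k\<le>r. (-1) ^ k * (real (card W choose k) * p ^ (2 * k)) * x ^ k)
        = (\<Sum>k\<le>r. (-1) ^ k * (real (card W choose k) * p ^ (2 * k) * (\<theta> * x ^ k)))"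
        unfolding sum_distrib_left by (intro sum.cong refl) (simp only: mult_ac)
      then show ?thesis by (simp only: right_diff_distrib sum_subtractf)
    qed
    also have "\<dots> \<le> (\<Sum>k\<le>r. \<bar>(-1) ^ k * (?E (\<lambda>G. of_bool (A G) * real (card (S G) choose k)) - real (card W choose k) * p ^ (2 * k) * (\<theta> * x ^ k))\<bar>)"
      by (rule sum_abs)
    also have "\<dots> \<le> (\<Sum>k\<le>r. \<delta> * (real (card W choose k) * p ^ (2 * k)))"
    proof (rule sum_mono)
      fix k assume k: "k \<in> {..r}"
      have "?E (\<lambda>G. of_bool (A G) * real (card (S G) choose k)) - real (card W choose k) * p ^ (2 * k) * (\<theta> * x ^ k)
        = (\<Sum>R\<in>[W]\<^bsup>k\<^esup>. p ^ (2 * k) * (alive_prob n p K (J \<union> ?SP R) i L1 (insert e L2 \<union> ?SP R) - \<theta> * x ^ k))"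
        unfolding moment right_diff_distrib sum_subtractf sum_constant card_nsets by (simp only: mult_ac)
      also have "\<bar>\<dots>\<bar> \<le> (\<Sum>R\<in>[W]\<^bsup>k\<^esup>. \<bar>p ^ (2 * k) * (alive_prob n p K (J \<union> ?SP R) i L1 (insert e L2 \<union> ?SP R) - \<theta> * x ^ k)\<bar>)"
        by (rule sum_abs)
      also have "\<dots> \<le> (\<Sum>R\<in>[W]\<^bsup>k\<^esup>. p ^ (2 * k) * \<delta>)"
      proof (rule sum_mono)
        fix R assume "R \<in> [W]\<^bsup>k\<^esup>"
        then have "R \<subseteq> W" "card R = k" by (auto simp: nsets_def)
        then have "\<bar>alive_prob n p K (J \<union> ?SP R) i L1 (insert e L2 \<union> ?SP R) - \<theta> * x ^ k\<bar> \<le> \<delta>"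
          using bound[of R] k by simp
        then show "\<bar>p ^ (2 * k) * (alive_prob n p K (J \<union> ?SP R) i L1 (insert e L2 \<union> ?SP R) - \<theta> * x ^ k)\<bar> \<le> p ^ (2 * k) * \<delta>"
          using p by (simp add: abs_mult mult_left_mono)
      qed
      also have "\<dots> = \<delta> * (real (card W choose k) * p ^ (2 * k))" by simp
      finally show "\<bar>(-1) ^ k * (?E (\<lambda>G. of_bool (A G) * real (card (S G) choose k)) - real (card W choose k) * p ^ (2 * k) * (\<theta> * x ^ k))\<bar>
        \<le> \<delta> * (real (card W choose k) * p ^ (2 * k))" by (simp add: abs_mult)
    qed
    finally show ?thesis unfolding sum_distrib_left .
  qed
  have "alive_prob n p K J i (insert e L1) L2 = ?E (\<lambda>G. of_bool (X G))"
    by (simp only: alive_prob_def X_def)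
  then show ?thesis using E1 E2 E3 unfolding V_def by linarith
qed

text \<open>The apexes in \<open>R\<close> lie off the vertices of \<open>J\<close>, so planted
  edges join each of them only to the two ends of \<open>e\<close>. Hence every new planted triangle
  has base \<open>e\<close> and an apex in \<open>R\<close>. Its class is \<open>i\<close>, which
  leaves the other edges of \<open>J\<close> as late as before and permits lateness \<open>i\<close>
  for \<open>e\<close> and the new spokes.\<close>

lemma late_UN_spokes:
  assumes J: "J \<subseteq> [{1..n}]\<^bsup>2\<^esup>" and e: "e \<in> J"
    and R: "\<And>w. w \<in> R \<Longrightarrow> w \<notin> \<Union>J \<and> (w + \<Sum>e) mod K = i"
  shows "f \<in> J \<Longrightarrow> f \<noteq> e \<Longrightarrow> late K J j f \<Longrightarrow> late K (J \<union> (\<Union>w\<in>R. spokes w e)) j f"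
    and "late K J i e \<Longrightarrow> late K (J \<union> (\<Union>w\<in>R. spokes w e)) i e"
    and "f \<in> (\<Union>w\<in>R. spokes w e) \<Longrightarrow> late K (J \<union> (\<Union>w\<in>R. spokes w e)) i f"
proof -
  let ?SP = "\<Union>w\<in>R. spokes w e"
  have cJ: "card g = 2" if "g \<in> J" for g using that J by (auto simp: nsets_def)
  have key: "spokes w g \<subseteq> J \<or> (g = e \<and> w \<in> R)" if g: "g \<in> J" and sp: "spokes w g \<subseteq> J \<union> ?SP" for w g
  proof -
    obtain x y where xy: "g = {x, y}" "x \<noteq> y" using cJ[OF g] by (auto simp: card_2_iff)
    have V: "x \<in> \<Union>J" "y \<in> \<Union>J" using xy g by auto
    have in_SP: "w \<in> R \<and> z \<in> e" if "{w, z} \<in> ?SP" "z \<in> \<Union>J" for z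
      using that R by (auto simp: UN_spokes doubleton_eq_iff)
    have in_J: "{w, z} \<notin> J" if "w \<in> R" for z using R[OF that] by blast
    have "{w, x} \<in> J \<union> ?SP" "{w, y} \<in> J \<union> ?SP" using sp xy by (auto simp: spokes_def)
    then have "({w, x} \<in> J \<and> {w, y} \<in> J) \<or> (w \<in> R \<and> x \<in> e \<and> y \<in> e)"
      using in_SP in_J V by blast
    moreover have "g = e" if "x \<in> e" "y \<in> e"
      using that cJ[OF e] xy by (auto simp: card_2_iff)
    ultimately show ?thesis using xy by (auto simp: spokes_def)
  qed
  show "late K (J \<union> ?SP) j f" if "f \<in> J" "f \<noteq> e" "late K J j f"
    using that key unfolding late_def by blast
  show "late K (J \<union> ?SP) i e" if "late K J i e"
    using that key[OF e] R unfolding late_def by (metis order_refl)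
  show "late K (J \<union> ?SP) i f" if f: "f \<in> ?SP"
  proof -
    obtain r z where rz: "f = {r, z}" "r \<in> R" "z \<in> e" using f by (auto simp: UN_spokes)
    have rJ: "r \<notin> \<Union>J" using R rz by auto
    have re: "r \<notin> e" using rJ e by auto
    show ?thesis unfolding late_def
    proof (intro allI impI)
      fix w assume w: "w \<notin> f" "spokes w f \<subseteq> J \<union> ?SP"
      \<comment> \<open>The edge from \<open>w\<close> to the new apex \<open>r\<close> is planted,
        so \<open>w\<close> is an end of \<open>e\<close>; being different from \<open>z\<close>, it
        is the other end, and the triangle is \<open>insert r e\<close> again.\<close>
      have "{w, r} \<in> J \<union> ?SP" using w rz by (auto simp: spokes_def)
      then have "{w, r} \<in> ?SP" using rJ by auto
      then have "w \<in> e" using R re rz by (auto simp: UN_spokes doubleton_eq_iff)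
      moreover have "w \<noteq> z" "w \<noteq> r" using w rz by auto
      ultimately have "e = {w, z}" using cJ[OF e] rz by (auto simp: card_2_iff)
      then have "w + \<Sum>f = r + \<Sum>e" using rz \<open>w \<noteq> z\<close> re by auto
      then show "i \<le> (w + \<Sum>f) mod K" using R rz by simp
    qed
  qed
qed

section \<open>Residue classes and the survival recursion\<close>

lemma card_residue_block:
  fixes K i s m :: nat
  assumes "i < K"
  shows "card {w \<in> {m<..m + K}. (w + s) mod K = i} = 1"
proof -
  let ?A = "{w \<in> {m<..m + K}. (w + s) mod K = i}"
  define t where "t = m + 1 + s"
  \<comment> \<open>\<open>w0\<close> is the solution of the congruence in the block; adding
    \<open>K * t\<close> keeps the difference of natural numbers from being truncated.\<close>
  define w0 where "w0 = m + 1 + (i + K * t - t) mod K"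
  have K: "K > 0" using assms by simp
  have "t \<le> K * t" using K by simp
  have "w0 + s = t + (i + K * t - t) mod K" by (simp add: w0_def t_def)
  then have "(w0 + s) mod K = (t + (i + K * t - t)) mod K" by (simp only: mod_add_right_eq)
  also have "t + (i + K * t - t) = i + K * t" using \<open>t \<le> K * t\<close> by linarith
  also have "(i + K * t) mod K = i" using assms by simp
  finally have 1: "(w0 + s) mod K = i" .
  have "(i + K * t - t) mod K < K" using K by simp
  then have w0: "w0 \<in> ?A" using 1 by (auto simp: w0_def)
  have uniq: "w = w0" if "w \<in> ?A" for w
  proof -
    have *: "(x + s) mod K = (y + s) mod K \<Longrightarrow> x \<in> {m<..m+K} \<Longrightarrow> y \<in> {m<..m+K} \<Longrightarrow> x \<le> y \<Longrightarrow> x = y" for x y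
    proof -
      assume a: "(x + s) mod K = (y + s) mod K" "x \<in> {m<..m+K}" "y \<in> {m<..m+K}" "x \<le> y"
      have "K dvd (y + s) - (x + s)" using a mod_eq_dvd_iff_nat[of "x + s" "y + s" K] by simp
      then have "K dvd y - x" by simp
      moreover have "y - x < K" using a by auto
      ultimately have "y - x = 0" using nat_dvd_not_less by blast
      then show "x = y" using a by simp
    qed
    have w: "(w + s) mod K = (w0 + s) mod K" "w \<in> {m<..m + K}" "w0 \<in> {m<..m + K}"
      using that w0 by simp_all
    show ?thesis
    proof (rule linorder_le_cases[of w w0])
      show "w = w0" if "w \<le> w0" by (rule *[OF w that])
      show "w = w0" if "w0 \<le> w" by (rule *[OF w(1)[symmetric] w(3,2) that, symmetric])
    qed
  qed
  have "?A = {w0}"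
  proof (intro equalityI subsetI)
    show "w \<in> {w0}" if "w \<in> ?A" for w using uniq[OF that] by (simp only: singleton_iff)
    show "w \<in> ?A" if "w \<in> {w0}" for w using that w0 by (simp only: singleton_iff)
  qed
  then have "card ?A = card {w0}" by (rule arg_cong)
  then show ?thesis by (simp only: card.empty card_insert_disjoint finite.emptyI empty_iff not_False_eq_True One_nat_def)
qed

text \<open>Removing a block of \<open>K\<close> consecutive numbers removes exactly one member of
  the class, and fewer than \<open>K\<close> consecutive numbers contain at most one.\<close>

lemma card_residue:
  fixes K i s n :: nat
  assumes "i < K"
  shows "\<bar>real (card {w \<in> {1..n}. (w + s) mod K = i}) - real n / real K\<bar> \<le> 1"
proof (induction n rule: less_induct)
  case (less n)
  have K: "K > 0" using assms by simp
  show ?case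
  proof (cases "n < K")
    case True
    have "card {w \<in> {1..n}. (w + s) mod K = i} \<le> card {w \<in> {0<..0 + K}. (w + s) mod K = i}"
      by (rule card_mono) (use True in auto)
    then have "card {w \<in> {1..n}. (w + s) mod K = i} \<le> 1" using card_residue_block[OF assms, of 0 s] by linarith
    moreover have "0 \<le> real n / real K" "real n / real K \<le> 1" using True by (auto simp: field_simps)
    ultimately show ?thesis by linarith
  next
    case False
    define m where "m = n - K"
    have n: "n = m + K" using False by (simp add: m_def)
    have "card {w \<in> {1..n}. (w + s) mod K = i} = card ({w \<in> {1..m}. (w + s) mod K = i} \<union> {w \<in> {m<..m + K}. (w + s) mod K = i})"
      using n by (intro arg_cong[where f = card]) auto
    also have "\<dots> = card {w \<in> {1..m}. (w + s) mod K = i} + 1"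
      using card_residue_block[OF assms] by (subst card_Un_disjoint) auto
    finally have "card {w \<in> {1..n}. (w + s) mod K = i} = card {w \<in> {1..m}. (w + s) mod K = i} + 1" .
    moreover have "real n / real K = real m / real K + 1" using K n by (simp add: field_simps)
    moreover have "m < n" using n K by simp
    ultimately show ?thesis using less[of m] by simp
  qed
qed

lemma card_residue_diff:
  fixes K i s n :: nat
  assumes "i < K" "finite V"
  shows "\<bar>real (card {w \<in> {1..n} - V. (w + s) mod K = i}) - real n / real K\<bar> \<le> real (card V) + 1"
proof -
  let ?A = "{w \<in> {1..n}. (w + s) mod K = i}"
  have *: "{w \<in> {1..n} - V. (w + s) mod K = i} = ?A - V" by auto
  have "card ?A - card V \<le> card (?A - V)" by (rule diff_card_le_card_Diff) (rule assms)
  then have 1: "real (card ?A) \<le> real (card (?A - V)) + real (card V)" by linarith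
  have "card (?A - V) \<le> card ?A" by (rule card_mono) auto
  then show ?thesis using 1 card_residue[OF assms(1), of n s] unfolding * by linarith
qed

section \<open>The survival recursion and its closed-form bound\<close>

primrec survival :: "real \<Rightarrow> nat \<Rightarrow> real" where
  "survival D 0 = 1"
| "survival D (Suc i) = survival D i * exp (- D * (survival D i)\<^sup>2)"

lemma survival_pos: "0 < survival D i"
  by (induction i) auto

lemma survival_le_1: "0 \<le> D \<Longrightarrow> survival D i \<le> 1"
proof (induction i)
  case (Suc i)
  have "survival D i * exp (- D * (survival D i)\<^sup>2) \<le> 1 * 1"
    using Suc by (intro mult_mono) auto
  then show ?case by simp
qed simp

text \<open>The recursion discretises \<open>q' = - D q^3\<close>, along whose solutions
  \<open>1/q^2\<close> grows at rate \<open>2 D\<close>. One round multiplies \<open>1/q^2\<close>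
  by \<open>exp (2 * D * q^2)\<close>, which is at least \<open>1 + 2 * D * q^2\<close>, so the
  discretisation errs in the useful direction.\<close>

lemma survival_bound:
  assumes "0 \<le> D"
  shows "1 + 2 * D * real i \<le> 1 / (survival D i)\<^sup>2"
proof (induction i)
  case (Suc i)
  define q where "q = survival D i"
  have q: "0 < q" using survival_pos q_def by simp
  have "1 + 2 * D * real (Suc i) \<le> 1 / q\<^sup>2 + 2 * D" using Suc by (simp add: q_def algebra_simps)
  also have "\<dots> = 1 / q\<^sup>2 * (1 + 2 * D * q\<^sup>2)" using q by (simp add: field_simps)
  also have "\<dots> \<le> 1 / q\<^sup>2 * exp (2 * D * q\<^sup>2)" by (intro mult_left_mono exp_ge_add_one_self) auto
  also have "\<dots> = 1 / (survival D (Suc i))\<^sup>2"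
    using q by (simp add: q_def[symmetric] power_mult_distrib exp_minus exp_double[symmetric] field_simps mult.assoc)
  finally show ?case .
qed simp

text \<open>With \<open>D = d / K\<close> and \<open>i = K\<close> the right-hand side is the power
  subtracted from 1 in \<open>xi d\<close>.\<close>

lemma survival_le_powr:
  assumes "0 \<le> D"
  shows "survival D i \<le> (2 * (D * real i) + 1) powr (- 1 / 2)"
proof -
  define q where "q = survival D i"
  define z where "z = 2 * (D * real i) + 1"
  have q: "0 < q" using survival_pos q_def by simp
  have z: "1 \<le> z" using assms by (simp add: z_def)
  have "z * q\<^sup>2 \<le> 1" using survival_bound[OF assms, of i] q by (simp add: q_def[symmetric] z_def field_simps)
  then have "q\<^sup>2 \<le> 1 / z" using z by (simp add: field_simps)
  then have "sqrt (q\<^sup>2) \<le> sqrt (1 / z)" by (rule real_sqrt_le_mono)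
  then have "q \<le> 1 / sqrt z" using q by (simp add: real_sqrt_divide)
  also have "\<dots> = z powr (- 1 / 2)" using z by (simp add: powr_minus_divide powr_half_sqrt)
  finally show ?thesis by (simp add: q_def z_def)
qed

section \<open>Asymptotics of the survival probabilities\<close>

locale constant_codegree =
  fixes p d :: "nat \<Rightarrow> real" and c C :: real
  assumes p: "0 \<le> p n" "p n \<le> 1"
    and d: "d n = (real n - 2) * (p n)\<^sup>2"
    and c: "0 < c" "c \<le> C"
    and d_bounds: "\<forall>\<^sub>F n in sequentially. c \<le> d n \<and> d n \<le> C"
begin

text \<open>Here \<open>n p^2 = d + 2 p^2\<close> with \<open>p \<le> 1\<close>.\<close>

lemma eventually_np2_le: "\<forall>\<^sub>F n in sequentially. real n * (p n)\<^sup>2 \<le> C + 2"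
  using d_bounds
proof eventually_elim
  case (elim n)
  have "(p n)\<^sup>2 \<le> 1" using p by (simp add: power_le_one)
  then show ?case using elim d[of n] by (simp add: algebra_simps)
qed

lemma p_tendsto_0: "p \<longlonglongrightarrow> 0"
proof -
  have "(\<lambda>n. (p n)\<^sup>2) \<longlonglongrightarrow> 0"
  proof (rule tendsto_sandwich[where f = "\<lambda>_. 0" and h = "\<lambda>n. (C + 2) / real n"])
    show "(\<lambda>n. (C + 2) / real n) \<longlonglongrightarrow> 0" by real_asymp
    show "\<forall>\<^sub>F n in sequentially. (p n)\<^sup>2 \<le> (C + 2) / real n"
      using eventually_np2_le eventually_gt_at_top[of 0]
      by eventually_elim (simp add: field_simps)
  qed auto
  then have "(\<lambda>n. sqrt ((p n)\<^sup>2)) \<longlonglongrightarrow> sqrt 0" by (rule tendsto_real_sqrt)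
  then show ?thesis using p by simp
qed

lemma eventually_p_le: "0 < \<epsilon> \<Longrightarrow> \<forall>\<^sub>F n in sequentially. p n \<le> \<epsilon>"
  using order_tendstoD(2)[OF p_tendsto_0, of \<epsilon>] by (auto elim: eventually_mono)

text \<open>The binomial moments of the number of apexes, out of \<open>w\<close>, with both spokes
  present are close to those of a Poisson variable of mean \<open>d / K\<close>. Passing from
  \<open>k\<close> to \<open>Suc k\<close> multiplies by \<open>(w - k) p^2 / (k + 1)\<close>, and
  \<open>(w - k) p^2\<close> differs from \<open>d / K\<close> by \<open>O(p^2)\<close>, uniformly
  for \<open>w\<close> in the window.\<close>

lemma choose_approx:
  fixes K :: nat and b \<eta> :: real
  assumes "0 < K" "0 \<le> b" "0 < \<eta>"
  shows "\<forall>\<^sub>F n in sequentially. \<forall>w::nat. \<bar>real w - real n / real K\<bar> \<le> b \<longrightarrow>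
    \<bar>real (w choose k) * p n ^ (2 * k) - (d n / real K) ^ k / fact k\<bar> \<le> \<eta>"
  using assms(3)
proof (induction k arbitrary: \<eta>)
  case 0
  then show ?case by simp
next
  case (Suc k)
  have C: "0 < C" using c by simp
  \<comment> \<open>Each error may use half of \<open>\<eta>\<close>: the old one is multiplied by
    at most \<open>C + 1\<close>, that of the new factor by at most \<open>C ^ k\<close>. The
    minimum with 1 in \<open>\<eta>2\<close> secures the bound \<open>C + 1\<close>.\<close>
  define \<eta>1 where "\<eta>1 = \<eta> / (2 * (C + 1))"
  define \<eta>2 where "\<eta>2 = min 1 (\<eta> / (2 * C ^ k)) / (b + 2 + real k)"
  have \<eta>1: "0 < \<eta>1" using Suc C by (simp add: \<eta>1_def)
  have \<eta>2: "0 < \<eta>2" using Suc C assms by (simp add: \<eta>2_def)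
  show ?case
    using Suc.IH[OF \<eta>1] eventually_p_le[OF \<eta>2] d_bounds
  proof eventually_elim
    case (elim n)
    show ?case
    proof (intro allI impI)
      fix w :: nat assume w: "\<bar>real w - real n / real K\<bar> \<le> b"
      define D where "D = d n / real K"
      define t where "t = real (w choose k) * p n ^ (2 * k)"
      define s where "s = D ^ k / fact k"
      define y where "y = (real w - real k) * (p n)\<^sup>2"
      have p2: "(p n)\<^sup>2 \<le> p n" using p[of n] by (simp add: power2_eq_square mult_left_le)
      have d0: "0 \<le> d n" "d n \<le> C" using elim c by auto
      have D: "0 \<le> D" "D \<le> C"
      proof -
        show "0 \<le> D" using d0 by (simp add: D_def)
        have "D \<le> d n / 1" unfolding D_def using d0 assms by (intro divide_left_mono) auto
        then show "D \<le> C" using d0 by simp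
      qed
      have ts: "\<bar>t - s\<bar> \<le> \<eta>1" using elim(1) w by (simp add: t_def s_def D_def)
      have "y - D = (real w - real n / real K + 2 / real K - real k) * (p n)\<^sup>2"
        by (simp add: y_def D_def d algebra_simps diff_divide_distrib add_divide_distrib)
      moreover have "2 / real K \<le> 2" "0 \<le> 2 / real K" using assms by (auto simp: field_simps)
      then have "\<bar>real w - real n / real K + 2 / real K - real k\<bar> \<le> b + 2 + real k" using w by linarith
      ultimately have "\<bar>y - D\<bar> \<le> (b + 2 + real k) * (p n)\<^sup>2"
        by (simp add: abs_mult mult_right_mono)
      also have "\<dots> \<le> (b + 2 + real k) * \<eta>2" using p2 elim assms by (intro mult_left_mono) auto
      also have "\<dots> = min 1 (\<eta> / (2 * C ^ k))" using assms by (simp add: \<eta>2_def)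
      finally have yD: "\<bar>y - D\<bar> \<le> 1" "\<bar>y - D\<bar> \<le> \<eta> / (2 * C ^ k)" by auto
      then have y: "\<bar>y\<bar> \<le> C + 1" using D by linarith
      have s: "0 \<le> s" "s \<le> C ^ k"
      proof -
        show "0 \<le> s" using D by (simp add: s_def)
        have "s \<le> D ^ k / 1" unfolding s_def using D by (intro divide_left_mono) auto
        also have "\<dots> \<le> C ^ k" using D by (simp add: power_mono)
        finally show "s \<le> C ^ k" .
      qed
      have "Suc k * (w choose Suc k) = (w - k) * (w choose k)"
      proof (cases w)
        case (Suc v)
        then show ?thesis using Suc_times_binomial_eq[of v k] binomial_absorb_comp[of w k] by (simp add: algebra_simps)
      qed simp
      then have "real (Suc k * (w choose Suc k)) = real ((w - k) * (w choose k))" by simp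
      \<comment> \<open>For \<open>w < k\<close> the natural difference is truncated to 0, but then
        \<open>w choose k\<close> is 0 as well.\<close>
      also have "\<dots> = (real w - real k) * real (w choose k)"
        by (cases "k \<le> w") (auto simp: of_nat_diff binomial_eq_0)
      finally have "real (w choose Suc k) = (real w - real k) * real (w choose k) / real (Suc k)"
        by (simp add: field_simps)
      then have 1: "real (w choose Suc k) * p n ^ (2 * Suc k) = t * y / real (Suc k)"
        by (simp add: t_def y_def power_add power2_eq_square)
      have 2: "D ^ Suc k / fact (Suc k) = s * D / real (Suc k)"
        by (simp add: s_def field_simps)
      have "\<bar>t * y - s * D\<bar> = \<bar>(t - s) * y + s * (y - D)\<bar>" by (simp add: algebra_simps)
      also have "\<dots> \<le> \<bar>t - s\<bar> * \<bar>y\<bar> + \<bar>s\<bar> * \<bar>y - D\<bar>" by (metis abs_mult abs_triangle_ineq)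
      also have "\<dots> \<le> \<eta>1 * (C + 1) + C ^ k * (\<eta> / (2 * C ^ k))"
        using ts y s yD C by (intro add_mono mult_mono) auto
      also have "\<dots> = \<eta>" using C by (simp add: \<eta>1_def field_simps)
      finally have "\<bar>t * y - s * D\<bar> \<le> \<eta>" .
      then have "\<bar>t * y - s * D\<bar> / real (Suc k) \<le> \<eta> / 1"
        using Suc.prems by (intro frac_le) auto
      then show "\<bar>real (w choose Suc k) * p n ^ (2 * Suc k) - (d n / real K) ^ Suc k / fact (Suc k)\<bar> \<le> \<eta>"
        unfolding D_def[symmetric] 1 2 by (simp add: diff_divide_distrib[symmetric] abs_divide)
    qed
  qed
qed

end

section \<open>Truncated exponential series and vertex counts\<close>

lemma sum_power_over_fact_le_exp:
  fixes x :: real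
  assumes "0 \<le> x"
  shows "(\<Sum>k\<le>r. x ^ k / fact k) \<le> exp x"
proof -
  obtain t where "exp x = (\<Sum>m<Suc r. x ^ m / fact m) + exp t / fact (Suc r) * x ^ Suc r"
    using Maclaurin_exp_le[of x "Suc r"] by blast
  moreover have "0 \<le> exp t / fact (Suc r) * x ^ Suc r" using assms by (intro mult_nonneg_nonneg) auto
  ultimately show ?thesis unfolding lessThan_Suc_atMost by linarith
qed

lemma exp_minus_partial_sum:
  fixes x M :: real
  assumes "0 \<le> x" "x \<le> M"
  shows "\<bar>(\<Sum>k\<le>r. (- x) ^ k / fact k) - exp (- x)\<bar> \<le> exp M * (M ^ Suc r / fact (Suc r))"
proof -
  obtain t where t: "\<bar>t\<bar> \<le> \<bar>- x\<bar>"
    "exp (- x) = (\<Sum>m<Suc r. (- x) ^ m / fact m) + exp t / fact (Suc r) * (- x) ^ Suc r"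
    using Maclaurin_exp_le[of "- x" "Suc r"] by blast
  have "\<bar>(\<Sum>k\<le>r. (- x) ^ k / fact k) - exp (- x)\<bar> = \<bar>exp t / fact (Suc r) * (- x) ^ Suc r\<bar>"
    unfolding t(2) lessThan_Suc_atMost by simp
  also have "\<dots> = exp t * (x ^ Suc r / fact (Suc r))"
    using assms by (simp add: abs_mult power_abs)
  also have "\<dots> \<le> exp M * (M ^ Suc r / fact (Suc r))"
    using t(1) assms by (intro mult_mono divide_right_mono power_mono) auto
  finally show ?thesis .
qed

lemma power_over_fact_tendsto_0: "(\<lambda>r. x ^ r / fact r :: real) \<longlonglongrightarrow> 0"
  using summable_LIMSEQ_zero[OF summable_exp[of x]] by (simp add: field_simps)

lemma card_Union_pairs_le:
  assumes "J \<subseteq> [A]\<^bsup>2\<^esup>" "finite J"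
  shows "card (\<Union>J) \<le> 2 * card J"
proof -
  have "card (\<Union>J) \<le> sum card J" by (rule card_Union_le_sum_card)
  also have "\<dots> = (\<Sum>g\<in>J. 2)" using assms by (intro sum.cong) (auto simp: nsets_def)
  finally show ?thesis by simp
qed

context constant_codegree
begin

text \<open>The induction statement; \<open>l\<close> counts the edges already advanced. Quantifying
  over all \<open>b\<close> and \<open>\<epsilon>\<close> lets the induction pass to larger planted
  sets and smaller errors. As \<open>d n\<close> need not converge, the target depends on
  \<open>n\<close>.\<close>

definition alive_prob_asymp :: "nat \<Rightarrow> nat \<Rightarrow> nat \<Rightarrow> bool" where
  "alive_prob_asymp K i l \<longleftrightarrow> (\<forall>b. \<forall>\<epsilon>>0. \<forall>\<^sub>F n in sequentially. \<forall>J L1 L2.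
     J \<subseteq> [{1..n}]\<^bsup>2\<^esup> \<longrightarrow> card J \<le> b \<longrightarrow> L1 \<subseteq> J \<longrightarrow> L2 \<subseteq> J \<longrightarrow> L1 \<inter> L2 = {} \<longrightarrow> card L1 = l \<longrightarrow>
     (\<forall>f\<in>L1. late K J (Suc i) f) \<longrightarrow> (\<forall>f\<in>L2. late K J i f) \<longrightarrow>
     \<bar>alive_prob n (p n) K J i L1 L2
       - survival (d n / real K) (Suc i) ^ l * survival (d n / real K) i ^ card L2\<bar> \<le> \<epsilon>)"

lemma alive_prob_asympD:
  assumes "alive_prob_asymp K i l" "0 < \<epsilon>"
  shows "\<forall>\<^sub>F n in sequentially. \<forall>J L1 L2.
     J \<subseteq> [{1..n}]\<^bsup>2\<^esup> \<longrightarrow> card J \<le> b \<longrightarrow> L1 \<subseteq> J \<longrightarrow> L2 \<subseteq> J \<longrightarrow> L1 \<inter> L2 = {} \<longrightarrow> card L1 = l \<longrightarrow>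
     (\<forall>f\<in>L1. late K J (Suc i) f) \<longrightarrow> (\<forall>f\<in>L2. late K J i f) \<longrightarrow>
     \<bar>alive_prob n (p n) K J i L1 L2
       - survival (d n / real K) (Suc i) ^ l * survival (d n / real K) i ^ card L2\<bar> \<le> \<epsilon>"
  using assms unfolding alive_prob_asymp_def by blast

lemma alive_prob_asymp_0: "alive_prob_asymp K 0 0"
proof -
  have "alive_prob n (p n) K J 0 {} L2 = 1" for n J L2
    by (simp add: alive_prob_def)
  moreover have "L1 = {}" if "J \<subseteq> [{1..n::nat}]\<^bsup>2\<^esup>" "L1 \<subseteq> J" "card L1 = 0" for J L1 n
  proof -
    have "finite L1" by (rule finite_subset[of _ "[{1..n}]\<^bsup>2\<^esup>"]) (use that in auto)
    then show ?thesis using that by simp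
  qed
  ultimately show ?thesis
    unfolding alive_prob_asymp_def
    by (intro allI impI always_eventually) (metis abs_zero diff_self less_imp_le mult_1 power_0 power_one survival.simps(1))
qed

text \<open>Once all edges are advanced, the set \<open>L1\<close> of round \<open>i\<close> serves
  as the set \<open>L2\<close> of round \<open>i + 1\<close>. It has at most \<open>b\<close> edges,
  so finitely many values of \<open>l\<close> need a common threshold.\<close>

lemma alive_prob_asymp_Suc_round:
  assumes "\<And>l. alive_prob_asymp K i l"
  shows "alive_prob_asymp K (Suc i) 0"
  unfolding alive_prob_asymp_def
proof (intro allI impI)
  fix b :: nat and \<epsilon> :: real assume \<epsilon>: "0 < \<epsilon>"
  have "\<forall>\<^sub>F n in sequentially. \<forall>l\<in>{..b}. \<forall>J L1 L2.
     J \<subseteq> [{1..n}]\<^bsup>2\<^esup> \<longrightarrow> card J \<le> b \<longrightarrow> L1 \<subseteq> J \<longrightarrow> L2 \<subseteq> J \<longrightarrow> L1 \<inter> L2 = {} \<longrightarrow> card L1 = l \<longrightarrow>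
     (\<forall>f\<in>L1. late K J (Suc i) f) \<longrightarrow> (\<forall>f\<in>L2. late K J i f) \<longrightarrow>
     \<bar>alive_prob n (p n) K J i L1 L2
       - survival (d n / real K) (Suc i) ^ l * survival (d n / real K) i ^ card L2\<bar> \<le> \<epsilon>"
    using alive_prob_asympD[OF assms \<epsilon>] by (intro eventually_ball_finite) auto
  then show "\<forall>\<^sub>F n in sequentially. \<forall>J L1 L2.
     J \<subseteq> [{1..n}]\<^bsup>2\<^esup> \<longrightarrow> card J \<le> b \<longrightarrow> L1 \<subseteq> J \<longrightarrow> L2 \<subseteq> J \<longrightarrow> L1 \<inter> L2 = {} \<longrightarrow> card L1 = 0 \<longrightarrow>
     (\<forall>f\<in>L1. late K J (Suc (Suc i)) f) \<longrightarrow> (\<forall>f\<in>L2. late K J (Suc i) f) \<longrightarrow>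
     \<bar>alive_prob n (p n) K J (Suc i) L1 L2
       - survival (d n / real K) (Suc (Suc i)) ^ 0 * survival (d n / real K) (Suc i) ^ card L2\<bar> \<le> \<epsilon>"
  proof eventually_elim
    case (elim n)
    show ?case
    proof (intro allI impI)
      fix J L1 L2 :: "nat set set"
      assume J: "J \<subseteq> [{1..n}]\<^bsup>2\<^esup>" "card J \<le> b" "L1 \<subseteq> J" "L2 \<subseteq> J" "card L1 = 0"
        "\<forall>f\<in>L2. late K J (Suc i) f"
      have fJ: "finite J" by (rule finite_subset[OF J(1)]) simp
      have "finite L1" using J(3) fJ by (rule finite_subset)
      then have "L1 = {}" using J by simp
      moreover have "card L2 \<le> b" using card_mono[OF fJ J(4)] J by linarith
      then have "\<bar>alive_prob n (p n) K J i L2 {}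
          - survival (d n / real K) (Suc i) ^ card L2 * survival (d n / real K) i ^ card ({} :: nat set set)\<bar> \<le> \<epsilon>"
        using elim[rule_format, of "card L2" J L2 "{}"] J by blast
      moreover have "alive_prob n (p n) K J (Suc i) {} L2 = alive_prob n (p n) K J i L2 {}"
        by (simp add: alive_prob_def)
      ultimately show "\<bar>alive_prob n (p n) K J (Suc i) L1 L2
       - survival (d n / real K) (Suc (Suc i)) ^ 0 * survival (d n / real K) (Suc i) ^ card L2\<bar> \<le> \<epsilon>"
        by simp
    qed
  qed
qed

text \<open>One edge \<open>e\<close> is advanced by \<open>alive_prob_step\<close>. The hypothesis
  is applied to planted sets enlarged by spokes, with \<open>e\<close> and all new spokes still at
  round \<open>i\<close>. The resulting alternating sum is close to \<open>exp (- D * q^2)\<close>,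
  the factor by which survival drops in one round.\<close>

lemma alive_prob_asymp_Suc_edge:
  assumes iK: "i < K" and IH: "alive_prob_asymp K i l"
  shows "alive_prob_asymp K i (Suc l)"
  unfolding alive_prob_asymp_def
proof (intro allI impI)
  fix b :: nat and \<epsilon> :: real assume \<epsilon>: "0 < \<epsilon>"
  have K: "0 < K" using iK by simp
  define M where "M = C + 2"
  have M: "0 < M" "C \<le> M" using c by (auto simp: M_def)
  have "(\<lambda>r. (1 + exp M) * (M ^ Suc r / fact (Suc r))) \<longlonglongrightarrow> (1 + exp M) * 0"
    by (intro tendsto_mult tendsto_const LIMSEQ_Suc power_over_fact_tendsto_0)
  then have "\<forall>\<^sub>F r in sequentially. (1 + exp M) * (M ^ Suc r / fact (Suc r)) < \<epsilon> / 8"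
    using \<epsilon> by (intro order_tendstoD(2)) auto
  \<comment> \<open>\<open>r\<close> controls both truncations: the summand 1 is for Bonferroni's
    remainder, \<open>exp M\<close> for that of the exponential series.\<close>
  then obtain r where r: "(1 + exp M) * (M ^ Suc r / fact (Suc r)) < \<epsilon> / 8"
    by (auto simp: eventually_sequentially)
  \<comment> \<open>\<open>\<delta>\<close> will be multiplied by a sum of at most
    \<open>exp M\<close>, and \<open>\<eta>\<close> added up over \<open>Suc r\<close> terms, so
    each contributes at most \<open>\<epsilon> / 8\<close>.\<close>
  define \<delta> where "\<delta> = \<epsilon> / (8 * exp M)"
  define \<eta> where "\<eta> = \<epsilon> / (8 * real (Suc r))"
  have \<delta>: "0 < \<delta>" and \<eta>: "0 < \<eta>" using \<epsilon> by (auto simp: \<delta>_def \<eta>_def)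
  have ap: "\<forall>\<^sub>F n in sequentially. \<forall>k\<in>{..r}. \<forall>w::nat. \<bar>real w - real n / real K\<bar> \<le> 2 * real b + 1 \<longrightarrow>
    \<bar>real (w choose k) * p n ^ (2 * k) - (d n / real K) ^ k / fact k\<bar> \<le> \<eta>"
    using K \<eta> by (intro eventually_ball_finite ballI choose_approx) auto
  have pe: "\<forall>\<^sub>F n in sequentially. p n \<le> \<epsilon> / (16 * (real b + 1))"
    using \<epsilon> by (intro eventually_p_le) auto
  show "\<forall>\<^sub>F n in sequentially. \<forall>J L1 L2.
     J \<subseteq> [{1..n}]\<^bsup>2\<^esup> \<longrightarrow> card J \<le> b \<longrightarrow> L1 \<subseteq> J \<longrightarrow> L2 \<subseteq> J \<longrightarrow> L1 \<inter> L2 = {} \<longrightarrow> card L1 = Suc l \<longrightarrow>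
     (\<forall>f\<in>L1. late K J (Suc i) f) \<longrightarrow> (\<forall>f\<in>L2. late K J i f) \<longrightarrow>
     \<bar>alive_prob n (p n) K J i L1 L2
       - survival (d n / real K) (Suc i) ^ Suc l * survival (d n / real K) i ^ card L2\<bar> \<le> \<epsilon>"
    \<comment> \<open>At most \<open>r\<close> apexes with two spokes each are planted in addition
      to \<open>J\<close>.\<close>
    using alive_prob_asympD[OF IH \<delta>, of "b + 2 * r"] ap pe eventually_np2_le d_bounds
  proof eventually_elim
    case (elim n)
    show ?case
    proof (intro allI impI)
      fix J L1' L2 :: "nat set set"
      assume J: "J \<subseteq> [{1..n}]\<^bsup>2\<^esup>" "card J \<le> b" "L1' \<subseteq> J" "L2 \<subseteq> J" "L1' \<inter> L2 = {}" "card L1' = Suc l"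
        and late1: "\<forall>f\<in>L1'. late K J (Suc i) f" and late2: "\<forall>f\<in>L2. late K J i f"
      have fJ: "finite J" by (rule finite_subset[OF J(1)]) simp
      have fL: "finite L1'" "finite L2" using J fJ finite_subset by auto
      obtain e L1 where e: "L1' = insert e L1" "e \<notin> L1" "card L1 = l"
        using J(6) card_Suc_eq[of L1' l] by metis
      have eJ: "e \<in> J" "e \<notin> L2" and L1: "L1 \<subseteq> J" "L1 \<inter> L2 = {}" using J e by auto
      have late_e: "late K J (Suc i) e" using late1 e by auto
      define W where "W = {w \<in> {1..n} - \<Union>J. (w + \<Sum>e) mod K = i}"
      define D where "D = d n / real K"
      define q where "q = survival D i"
      define q' where "q' = survival D (Suc i)"
      \<comment> \<open>\<open>\<theta>\<close> predicts the probability with \<open>e\<close> still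
        at round \<open>i\<close>; \<open>x\<close> is the factor contributed by the two spokes of
        one apex.\<close>
      define \<theta> where "\<theta> = q' ^ l * q ^ Suc (card L2)"
      define x where "x = q\<^sup>2"
      define T where "T k = real (card W choose k) * p n ^ (2 * k)" for k
      let ?SP = "\<lambda>R. \<Union>w\<in>R. spokes w e"
      have d0: "0 \<le> d n" "d n \<le> C" using elim c by auto
      have D: "0 \<le> D" "D \<le> M"
      proof -
        show "0 \<le> D" using d0 by (simp add: D_def)
        have "D \<le> d n / 1" unfolding D_def using d0 K by (intro divide_left_mono) auto
        then show "D \<le> M" using d0 M by simp
      qed
      have q: "0 < q" "q \<le> 1" "0 < q'" "q' \<le> 1"
        using D by (auto simp: q_def q'_def survival_pos survival_le_1 simp del: survival.simps)
      have \<theta>: "0 \<le> \<theta>" "\<theta> \<le> 1" using q unfolding \<theta>_def by (auto intro!: mult_le_one power_le_one)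
      have x: "0 \<le> x" "x \<le> 1" using q by (auto simp: x_def power_le_one)
      have pn: "0 \<le> p n" "p n \<le> 1" using p by auto
      have eP: "e \<in> [{1..n}]\<^bsup>2\<^esup>" using eJ J by auto
      have e2: "card e = 2" using eP by (auto simp: nsets_def)
      have bound: "\<bar>alive_prob n (p n) K (J \<union> ?SP R) i L1 (insert e L2 \<union> ?SP R) - \<theta> * x ^ card R\<bar> \<le> \<delta>"
        if R: "R \<subseteq> W" "card R \<le> r" for R
      proof -
        have RW: "\<And>w. w \<in> R \<Longrightarrow> w \<notin> \<Union>J \<and> (w + \<Sum>e) mod K = i" using R by (auto simp: W_def)
        have Re: "R \<inter> e = {}" using RW eJ by auto
        have "spokes w e \<inter> J = {}" if "w \<in> R" for w
          by (rule spokes_Int_outside) (use RW[OF that] in simp)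
        then have SPJ: "?SP R \<inter> J = {}" by fast
        have SPP: "?SP R \<subseteq> [{1..n}]\<^bsup>2\<^esup>"
          by (rule UN_spokes_subset_pairs[OF Re _ eP]) (use R in \<open>auto simp: W_def\<close>)
        have fSP: "finite (?SP R)" by (rule finite_subset[OF SPP]) simp
        have cSP: "card (?SP R) = 2 * card R" by (rule card_UN_spokes[OF Re e2])
        have cJ: "card (J \<union> ?SP R) \<le> b + 2 * r"
          using card_Un_le[of J "?SP R"] cSP J R by linarith
        have cL: "card (insert e L2 \<union> ?SP R) = Suc (card L2) + 2 * card R"
        proof -
          have "card (insert e L2 \<union> ?SP R) = card (insert e L2) + card (?SP R)"
            using fL fSP SPJ eJ J by (intro card_Un_disjoint) auto
          then show ?thesis using fL eJ cSP by simp
        qed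
        have l1: "\<forall>f\<in>L1. late K (J \<union> ?SP R) (Suc i) f"
          using late_UN_spokes(1)[OF J(1) eJ(1) RW] L1 late1 e by blast
        have "late K J i e" using late_e by (auto simp: late_def)
        then have l2: "late K (J \<union> ?SP R) i f" if "f \<in> insert e L2 \<union> ?SP R" for f
        proof -
          consider "f = e" | "f \<in> L2" "f \<noteq> e" | "f \<in> ?SP R" using \<open>f \<in> insert e L2 \<union> ?SP R\<close> by blast
          then show ?thesis
          proof cases
            case 1
            then show ?thesis using late_UN_spokes(2)[OF J(1) eJ(1) RW] \<open>late K J i e\<close> by simp
          next
            case 2
            then show ?thesis using late_UN_spokes(1)[OF J(1) eJ(1) RW] J(4) late2 by blast
          next
            case 3
            show ?thesis by (rule late_UN_spokes(3)[OF J(1) eJ(1) RW 3])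
          qed
        qed
        have "\<bar>alive_prob n (p n) K (J \<union> ?SP R) i L1 (insert e L2 \<union> ?SP R)
          - q' ^ l * q ^ card (insert e L2 \<union> ?SP R)\<bar> \<le> \<delta>"
          unfolding q_def q'_def D_def
        proof (rule elim(1)[rule_format])
          show "J \<union> ?SP R \<subseteq> [{1..n}]\<^bsup>2\<^esup>" using J(1) SPP by blast
          show "L1 \<inter> (insert e L2 \<union> ?SP R) = {}" using L1 e SPJ by blast
          show "L1 \<subseteq> J \<union> ?SP R" "insert e L2 \<union> ?SP R \<subseteq> J \<union> ?SP R" using L1 J eJ by blast+
          show "late K (J \<union> ?SP R) (Suc i) f" if "f \<in> L1" for f using l1 that by blast
          show "late K (J \<union> ?SP R) i f" if "f \<in> insert e L2 \<union> ?SP R" for f using that by (rule l2)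
        qed (use cJ e in auto)
        then show ?thesis unfolding cL \<theta>_def x_def by (simp add: power_add power_mult mult.assoc)
      qed
      have step: "\<bar>alive_prob n (p n) K J i (insert e L1) L2 - \<theta> * (\<Sum>k\<le>r. (-1) ^ k * T k * x ^ k)\<bar>
        \<le> \<delta> * (\<Sum>k\<le>r. T k) + T (Suc r) + real (card (\<Union>J)) * p n"
        using alive_prob_step[OF pn J(1) eJ(1) late_e, where r = r and x = x and \<theta> = \<theta> and \<delta> = \<delta>,
            folded W_def, OF bound]
        by (simp add: T_def)
      have T: "0 \<le> T k" "T k \<le> M ^ k / fact k" for k
      proof -
        show "0 \<le> T k" using pn by (simp add: T_def)
        have "card W \<le> card {1..n}" by (rule card_mono) (auto simp: W_def)
        then have "card W \<le> n" by simp
        have "(card W choose k) * fact k \<le> card W ^ k" by (rule binomial_fact_pow)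
        also have "\<dots> \<le> n ^ k" using \<open>card W \<le> n\<close> by (rule power_mono) simp
        finally have "real ((card W choose k) * fact k) \<le> real (n ^ k)" by (rule of_nat_mono)
        then have "real (card W choose k) \<le> real n ^ k / fact k" by (simp add: field_simps)
        then have "T k \<le> real n ^ k / fact k * p n ^ (2 * k)"
          unfolding T_def using pn by (intro mult_right_mono) auto
        also have "\<dots> = (real n * (p n)\<^sup>2) ^ k / fact k" by (simp add: power_mult_distrib power_mult)
        also have "\<dots> \<le> M ^ k / fact k" using elim by (intro divide_right_mono power_mono) (auto simp: M_def)
        finally show "T k \<le> M ^ k / fact k" .
      qed
      have "(\<Sum>k\<le>r. T k) \<le> (\<Sum>k\<le>r. M ^ k / fact k)" by (rule sum_mono) (rule T)
      also have "\<dots> \<le> exp M" using M by (intro sum_power_over_fact_le_exp) simp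
      finally have "\<delta> * (\<Sum>k\<le>r. T k) \<le> \<delta> * exp M" using \<delta> by (intro mult_left_mono) auto
      then have b1: "\<delta> * (\<Sum>k\<le>r. T k) \<le> \<epsilon> / 8" by (simp add: \<delta>_def)
      have cV: "card (\<Union>J) \<le> 2 * b" using card_Union_pairs_le[OF J(1) fJ] J(2) by linarith
      have "real (card (\<Union>J)) * p n \<le> (2 * real b) * (\<epsilon> / (16 * (real b + 1)))"
        using cV elim pn by (intro mult_mono) auto
      also have "\<dots> \<le> \<epsilon> / 8" using \<epsilon> by (simp add: field_simps)
      finally have b2: "real (card (\<Union>J)) * p n \<le> \<epsilon> / 8" .
      have fV: "finite (\<Union>J)" using fJ J(1) by (auto simp: nsets_def)
      have "\<bar>real (card W) - real n / real K\<bar> \<le> real (card (\<Union>J)) + 1"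
        unfolding W_def by (rule card_residue_diff[OF iK fV])
      then have cW: "\<bar>real (card W) - real n / real K\<bar> \<le> 2 * real b + 1" using cV by linarith
      have "\<bar>(\<Sum>k\<le>r. (-1) ^ k * T k * x ^ k) - (\<Sum>k\<le>r. (- (D * x)) ^ k / fact k)\<bar>
        = \<bar>\<Sum>k\<le>r. (-1) ^ k * x ^ k * (T k - D ^ k / fact k)\<bar>"
        unfolding sum_subtractf[symmetric]
        by (intro arg_cong[where f = abs] sum.cong refl)
          (simp add: algebra_simps power_mult_distrib[symmetric])
      also have "\<dots> \<le> (\<Sum>k\<le>r. \<bar>(-1) ^ k * x ^ k * (T k - D ^ k / fact k)\<bar>)" by (rule sum_abs)
      also have "\<dots> \<le> (\<Sum>k\<le>r. \<eta>)"
      proof (rule sum_mono)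
        fix k assume "k \<in> {..r}"
        then have "\<bar>T k - D ^ k / fact k\<bar> \<le> \<eta>" using elim(2) cW by (auto simp: T_def D_def)
        moreover have "x ^ k \<le> 1" "0 \<le> x ^ k" using x by (auto simp: power_le_one)
        ultimately have "x ^ k * \<bar>T k - D ^ k / fact k\<bar> \<le> 1 * \<eta>" by (intro mult_mono) auto
        then show "\<bar>(-1) ^ k * x ^ k * (T k - D ^ k / fact k)\<bar> \<le> \<eta>"
          using x by (simp add: abs_mult power_abs)
      qed
      also have "\<dots> = \<epsilon> / 8" by (simp add: \<eta>_def field_simps)
      finally have s1: "\<bar>(\<Sum>k\<le>r. (-1) ^ k * T k * x ^ k) - (\<Sum>k\<le>r. (- (D * x)) ^ k / fact k)\<bar> \<le> \<epsilon> / 8" .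
      have "D * x \<le> M * 1" using D x M by (intro mult_mono) auto
      then have s2: "\<bar>(\<Sum>k\<le>r. (- (D * x)) ^ k / fact k) - exp (- (D * x))\<bar> \<le> exp M * (M ^ Suc r / fact (Suc r))"
        using D x by (intro exp_minus_partial_sum) auto
      have "\<bar>(\<Sum>k\<le>r. (-1) ^ k * T k * x ^ k) - exp (- (D * x))\<bar> \<le> \<epsilon> / 8 + exp M * (M ^ Suc r / fact (Suc r))"
        using s1 s2 by linarith
      then have "\<theta> * \<bar>(\<Sum>k\<le>r. (-1) ^ k * T k * x ^ k) - exp (- (D * x))\<bar> \<le> 1 * (\<epsilon> / 8 + exp M * (M ^ Suc r / fact (Suc r)))"
        using \<theta> by (intro mult_mono) auto
      then have s3: "\<bar>\<theta> * (\<Sum>k\<le>r. (-1) ^ k * T k * x ^ k) - \<theta> * exp (- (D * x))\<bar> \<le> \<epsilon> / 8 + exp M * (M ^ Suc r / fact (Suc r))"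
        using \<theta> by (simp add: abs_mult right_diff_distrib[symmetric])
      \<comment> \<open>Here the recursion for \<open>survival\<close> enters: the exponential turns
        one factor \<open>q\<close> of \<open>\<theta>\<close> into \<open>q'\<close>.\<close>
      have "\<theta> * exp (- (D * x)) = q' ^ Suc l * q ^ card L2"
        by (simp add: \<theta>_def x_def q'_def q_def)
      moreover have "T (Suc r) \<le> M ^ Suc r / fact (Suc r)" by (rule T)
      moreover have "M ^ Suc r / fact (Suc r) + exp M * (M ^ Suc r / fact (Suc r)) < \<epsilon> / 8"
        using r by (simp only: distrib_right mult_1)
      ultimately have "\<bar>alive_prob n (p n) K J i (insert e L1) L2 - q' ^ Suc l * q ^ card L2\<bar> \<le> \<epsilon>"
        using step b1 b2 s3 \<epsilon> by linarith
      then show "\<bar>alive_prob n (p n) K J i L1' L2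
       - survival (d n / real K) (Suc i) ^ Suc l * survival (d n / real K) i ^ card L2\<bar> \<le> \<epsilon>"
        unfolding e(1) q_def q'_def D_def .
    qed
  qed
qed

text \<open>The outer induction runs over rounds, the inner one over advanced edges; the latter
  needs \<open>i < K\<close>, so that class \<open>i\<close> is a residue class.\<close>

lemma alive_prob_asymp_all:
  assumes "i \<le> K"
  shows "alive_prob_asymp K i 0"
  using assms
proof (induction i)
  case 0
  show ?case by (rule alive_prob_asymp_0)
next
  case (Suc i)
  have "alive_prob_asymp K i l" for l
    by (induction l) (use Suc in \<open>auto intro: alive_prob_asymp_Suc_edge\<close>)
  then show ?case by (rule alive_prob_asymp_Suc_round)
qed

end

section \<open>From killed edges to a packing\<close>

lemma nsets_2_insert:
  assumes "card e = 2" "w \<notin> e"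
  shows "[insert w e]\<^bsup>2\<^esup> = insert e (spokes w e)"
  using assms by (auto simp: card_2_iff nsets_2_eq spokes_def doubleton_eq_iff)

lemma triangle_edgeE:
  assumes "card T = 3" "e \<in> [T]\<^bsup>2\<^esup>"
  obtains w where "w \<notin> e" "T = insert w e" "[T]\<^bsup>2\<^esup> = insert e (spokes w e)"
proof -
  have e: "e \<subseteq> T" "card e = 2" "finite e" using assms by (auto simp: nsets_def)
  then have "card (T - e) = 1" using assms by (simp add: card_Diff_subset)
  then obtain w where w: "T - e = {w}" by (auto simp: card_1_singleton_iff)
  then have "w \<notin> e" "T = insert w e" using e by auto
  then show thesis using that nsets_2_insert e by metis
qed

lemma card_nsets_3_2:
  assumes "card T = 3"
  shows "card ([T]\<^bsup>2\<^esup>) = 3"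
proof -
  have "finite T" using assms by (intro card_ge_0_finite) simp
  then show ?thesis using assms by (simp add: choose_two)
qed

lemma triangles_subset:
  assumes "G \<subseteq> [A]\<^bsup>2\<^esup>"
  shows "triangles G \<subseteq> Pow A"
proof (intro subsetI PowI)
  fix T x assume T: "T \<in> triangles G" and x: "x \<in> T"
  have "card T = 3" using T by (simp add: triangles_def)
  then have "card (T - {x}) = 2" using x by simp
  then obtain y where "y \<in> T" "y \<noteq> x" by (auto simp: card_2_iff)
  then have "{x, y} \<in> [T]\<^bsup>2\<^esup>" using x by simp
  moreover have "[T]\<^bsup>2\<^esup> \<subseteq> [A]\<^bsup>2\<^esup>" using T assms by (auto simp: triangles_def)
  ultimately have "{x, y} \<in> [A]\<^bsup>2\<^esup>" by (rule subsetD[rotated])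
  then show "x \<in> A" by simp
qed

lemma card_le_nu:
  assumes "finite A" "G \<subseteq> [A]\<^bsup>2\<^esup>" "triangle_packing G F"
  shows "card F \<le> nu G"
proof -
  have "finite (triangles G)"
    using triangles_subset[OF assms(2)] by (rule finite_subset) (simp add: assms)
  then have "finite {F. F \<subseteq> triangles G}" by simp
  then have "finite {F. triangle_packing G F}"
    by (rule rev_finite_subset) (auto simp: triangle_packing_def)
  then have "finite {card F |F. triangle_packing G F}" by simp
  then show ?thesis unfolding nu_def using assms by (intro Max_ge) auto
qed

lemma alive_antimono: "alive n K G j e \<Longrightarrow> i \<le> j \<Longrightarrow> alive n K G i e"
  by (induction j) (auto simp: le_Suc_eq)

definition killed :: "nat \<Rightarrow> nat \<Rightarrow> nat set set \<Rightarrow> nat set set" where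
  "killed n K G = {e \<in> G. \<not> alive n K G K e}"

text \<open>Ordered pairs of distinct triangles of \<open>G\<close> in one class with the common
  edge \<open>e\<close>. Aliveness is left out, so that the expectation only involves counting
  configurations of five edges.\<close>

definition clashes :: "nat \<Rightarrow> nat \<Rightarrow> nat set set \<Rightarrow> (nat set \<times> nat \<times> nat) set" where
  "clashes n K G = {(e, w, w'). e \<in> [{1..n}]\<^bsup>2\<^esup> \<and> w \<in> {1..n} - e \<and> w' \<in> {1..n} - e \<and> w \<noteq> w' \<and>
     (w + \<Sum>e) mod K = (w' + \<Sum>e) mod K \<and> insert e (spokes w e \<union> spokes w' e) \<subseteq> G}"

lemma finite_clashes: "finite (clashes n K G)"
proof (rule finite_subset)
  show "clashes n K G \<subseteq> [{1..n}]\<^bsup>2\<^esup> \<times> {1..n} \<times> {1..n}" by (auto simp: clashes_def)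
qed simp

lemma not_alive_witness:
  "\<not> alive n K G j e \<Longrightarrow> \<exists>i<j. alive n K G i e \<and> (\<exists>w\<in>{1..n} - e. (w + \<Sum>e) mod K = i \<and>
     (\<forall>f\<in>spokes w e. f \<in> G \<and> alive n K G i f))"
  by (induction j) (auto simp: less_Suc_eq)

text \<open>Every killed edge lies in a used triangle, which has three edges. Used triangles of
  different rounds share no edge, as the earlier one kills its edges. Those sharing an edge with
  another one of their round are dropped, and each dropped triangle is the first one of some
  clash.\<close>

lemma card_killed_le:
  assumes G: "G \<subseteq> [{1..n}]\<^bsup>2\<^esup>"
  shows "card (killed n K G) \<le> 3 * (nu G + card (clashes n K G))"
proof -
  \<comment> \<open>\<open>\<T>\<close> consists of the used triangles, whose edges are all alive in
    the round given by their class; \<open>F\<close> is the packing left after the conflicts within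
    rounds are removed.\<close>
  define \<T> where "\<T> = {T \<in> triangles G. \<forall>f\<in>[T]\<^bsup>2\<^esup>. alive n K G (\<Sum>T mod K) f}"
  define F where "F = {T \<in> \<T>. \<forall>S\<in>\<T>. S \<noteq> T \<longrightarrow> \<Sum>S mod K = \<Sum>T mod K \<longrightarrow> disjnt ([S]\<^bsup>2\<^esup>) ([T]\<^bsup>2\<^esup>)}"
  have c3: "card T = 3" "[T]\<^bsup>2\<^esup> \<subseteq> G" "T \<subseteq> {1..n}" if "T \<in> \<T>" for T
    using that triangles_subset[OF G] by (auto simp: \<T>_def triangles_def)
  have f\<T>: "finite \<T>"
    by (rule finite_subset[of _ "Pow {1..n}"]) (use c3(3) in blast, simp)
  have eG: "card e = 2" "finite e" if "e \<in> G" for e using that G by (auto simp: nsets_def)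
  have split: "\<exists>w. w \<in> {1..n} - e \<and> T = insert w e \<and> spokes w e \<subseteq> [T]\<^bsup>2\<^esup> \<and> e \<in> G \<and> \<Sum>T = w + \<Sum>e"
    if T: "T \<in> \<T>" "e \<in> [T]\<^bsup>2\<^esup>" for T e
  proof -
    obtain w where w: "w \<notin> e" "T = insert w e" "[T]\<^bsup>2\<^esup> = insert e (spokes w e)"
      using triangle_edgeE[OF c3(1)[OF T(1)] T(2)] by blast
    moreover have "e \<in> G" using T c3 by blast
    moreover have "\<Sum>T = w + \<Sum>e" using w eG[OF \<open>e \<in> G\<close>] by simp
    ultimately show ?thesis using c3(3)[OF T(1)] by blast
  qed
  have earlier: False if "S \<in> \<T>" "T \<in> \<T>" "\<Sum>S mod K < \<Sum>T mod K" "e \<in> [S]\<^bsup>2\<^esup>" "e \<in> [T]\<^bsup>2\<^esup>" for S T e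
  proof -
    obtain w where w: "w \<in> {1..n} - e" "spokes w e \<subseteq> [S]\<^bsup>2\<^esup>" "\<Sum>S = w + \<Sum>e"
      using split[OF \<open>S \<in> \<T>\<close> \<open>e \<in> [S]\<^bsup>2\<^esup>\<close>] by blast
    have "\<forall>f\<in>spokes w e. f \<in> G \<and> alive n K G (\<Sum>S mod K) f"
      using w \<open>S \<in> \<T>\<close> c3(2)[OF \<open>S \<in> \<T>\<close>] by (auto simp: \<T>_def)
    then have "\<not> alive n K G (Suc (\<Sum>S mod K)) e" using w by auto
    moreover have "alive n K G (\<Sum>T mod K) e" using that by (auto simp: \<T>_def)
    ultimately show False using that(3) alive_antimono[of n K G "\<Sum>T mod K" e "Suc (\<Sum>S mod K)"] by linarith
  qed
  have "triangle_packing G F"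
    unfolding triangle_packing_def
  proof (intro conjI pairwiseI)
    show "F \<subseteq> triangles G" by (auto simp: F_def \<T>_def)
    fix S T assume ST: "S \<in> F" "T \<in> F" "S \<noteq> T"
    then have *: "S \<in> \<T>" "T \<in> \<T>" by (auto simp: F_def)
    show "disjnt ([S]\<^bsup>2\<^esup>) ([T]\<^bsup>2\<^esup>)"
    proof (cases "\<Sum>S mod K = \<Sum>T mod K")
      case True
      then show ?thesis using ST * by (auto simp: F_def)
    next
      case False
      then show ?thesis using earlier[OF *] earlier[OF *(2,1)] unfolding disjnt_iff by (meson nat_neq_iff)
    qed
  qed
  then have nu: "card F \<le> nu G" using G by (intro card_le_nu[of "{1..n}"]) auto
  have "\<T> - F \<subseteq> (\<lambda>(e, w, w'). insert w e) ` clashes n K G"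
  proof
    fix T assume "T \<in> \<T> - F"
    then obtain S where S: "T \<in> \<T>" "S \<in> \<T>" "S \<noteq> T" "\<Sum>S mod K = \<Sum>T mod K" "\<not> disjnt ([S]\<^bsup>2\<^esup>) ([T]\<^bsup>2\<^esup>)"
      by (auto simp: F_def)
    then obtain e where e: "e \<in> [S]\<^bsup>2\<^esup>" "e \<in> [T]\<^bsup>2\<^esup>" by (auto simp: disjnt_iff)
    obtain w where w: "w \<in> {1..n} - e" "T = insert w e" "spokes w e \<subseteq> [T]\<^bsup>2\<^esup>" "e \<in> G" "\<Sum>T = w + \<Sum>e"
      using split[OF S(1) e(2)] by blast
    obtain w' where w': "w' \<in> {1..n} - e" "S = insert w' e" "spokes w' e \<subseteq> [S]\<^bsup>2\<^esup>" "\<Sum>S = w' + \<Sum>e"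
      using split[OF S(2) e(1)] by blast
    have "w \<noteq> w'" using w(2) w'(2) S(3) by blast
    moreover have "insert e (spokes w e \<union> spokes w' e) \<subseteq> G"
      using subset_trans[OF w(3) c3(2)[OF S(1)]] subset_trans[OF w'(3) c3(2)[OF S(2)]] w(4) by simp
    moreover have "(w + \<Sum>e) mod K = (w' + \<Sum>e) mod K" using S(4) w(5) w'(4) by simp
    moreover have "e \<in> [{1..n}]\<^bsup>2\<^esup>" using w(4) G by blast
    ultimately have "(e, w, w') \<in> clashes n K G" using w(1) w'(1) by (simp add: clashes_def)
    then show "T \<in> (\<lambda>(e, w, w'). insert w e) ` clashes n K G"
      by (rule rev_image_eqI) (simp only: w(2) prod.case)
  qed
  then have "card (\<T> - F) \<le> card (clashes n K G)" by (rule surj_card_le[OF finite_clashes])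
  moreover have "card \<T> \<le> card F + card (\<T> - F)"
  proof -
    have "\<T> = F \<union> (\<T> - F)" by (auto simp: F_def)
    then show ?thesis using card_Un_le[of F "\<T> - F"] by simp
  qed
  ultimately have c\<T>: "card \<T> \<le> nu G + card (clashes n K G)" using nu by linarith
  have "killed n K G \<subseteq> (\<Union>T\<in>\<T>. [T]\<^bsup>2\<^esup>)"
  proof
    fix e assume "e \<in> killed n K G"
    then have e: "e \<in> G" "\<not> alive n K G K e" by (auto simp: killed_def)
    \<comment> \<open>In the round in which \<open>e\<close> is killed it is still alive, so all
      three edges of the killing triangle are, and the triangle belongs to
      \<open>\<T>\<close>.\<close>
    obtain i w where iw: "alive n K G i e" "w \<in> {1..n} - e" "(w + \<Sum>e) mod K = i"
      "\<forall>f\<in>spokes w e. f \<in> G \<and> alive n K G i f"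
      using not_alive_witness[OF e(2)] by blast
    have T: "[insert w e]\<^bsup>2\<^esup> = insert e (spokes w e)" using iw eG[OF e(1)] by (intro nsets_2_insert) auto
    have "card (insert w e) = 3" "\<Sum>(insert w e) = w + \<Sum>e" using iw eG[OF e(1)] by auto
    then have "insert w e \<in> \<T>" using T iw e by (auto simp: \<T>_def triangles_def)
    then show "e \<in> (\<Union>T\<in>\<T>. [T]\<^bsup>2\<^esup>)" using T by blast
  qed
  then have "card (killed n K G) \<le> card (\<Union>T\<in>\<T>. [T]\<^bsup>2\<^esup>)"
    by (rule card_mono[rotated]) (use f\<T> c3 in \<open>auto intro!: finite_imp_finite_nsets card_ge_0_finite\<close>)
  also have "\<dots> \<le> (\<Sum>T\<in>\<T>. card ([T]\<^bsup>2\<^esup>))" by (rule card_UN_le[OF f\<T>])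
  also have "\<dots> = 3 * card \<T>" using c3(1) by (simp add: card_nsets_3_2 del: card_nsets)
  also have "\<dots> \<le> 3 * (nu G + card (clashes n K G))" using c\<T> by (rule mult_le_mono2)
  finally show ?thesis .
qed

section \<open>Concentration of the number of killed edges\<close>

text \<open>A planted triangle on \<open>f\<close> would need three planted edges, \<open>f\<close>
  and two spokes.\<close>

lemma late_if_card_le_2:
  assumes J: "J \<subseteq> [{1..n::nat}]\<^bsup>2\<^esup>" "card J \<le> 2" and f: "f \<in> J"
  shows "late K J i f"
  unfolding late_def
proof (intro allI impI)
  fix w assume w: "w \<notin> f" "spokes w f \<subseteq> J"
  have fJ: "finite J" by (rule finite_subset[OF J(1)]) simp
  have f2: "card f = 2" "finite f" using J f by (auto simp: nsets_def)
  have "card (spokes w f) = 2" using card_UN_spokes[of "{w}" f] w f2 by simp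
  moreover have "f \<notin> spokes w f" using w by (auto simp: spokes_def)
  ultimately have "card (insert f (spokes w f)) = 3" using f2 by (simp add: finite_spokes)
  moreover have "card (insert f (spokes w f)) \<le> card J" using w f by (intro card_mono fJ) auto
  ultimately show "i \<le> (w + \<Sum>f) mod K" using J by simp
qed

text \<open>Two distinct triangles with a common edge have five edges in all. The second apex is
  confined to the residue class of the first, which gives \<open>n / K + 1\<close> choices instead
  of \<open>n\<close> and hence the decisive factor \<open>1 / K\<close>.\<close>

lemma expectation_clashes_le:
  assumes "0 < K" "0 \<le> p" "p \<le> 1"
  shows "measure_pmf.expectation (random_graph n p) (\<lambda>G. real (card (clashes n K G)))
    \<le> real (n choose 2) * (real n * (real n / real K + 1)) * p ^ 5"
proof -
  let ?P = "[{1..n}]\<^bsup>2\<^esup>"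
  let ?E = "measure_pmf.expectation (random_graph n p) :: (nat set set \<Rightarrow> real) \<Rightarrow> real"
  let ?J = "\<lambda>(e, w, w'). insert e (spokes w e \<union> spokes w' e)"
  define \<Omega> where "\<Omega> = {(e, w, w'). e \<in> ?P \<and> w \<in> {1..n} - e \<and> w' \<in> {1..n} - e \<and> w \<noteq> w' \<and>
     (w + \<Sum>e) mod K = (w' + \<Sum>e) mod K}"
  \<comment> \<open>A superset in the form of a nested dependent sum, which can be counted fibre by
    fibre.\<close>
  define \<Omega>' where "\<Omega>' = (SIGMA e:?P. SIGMA w:{1..n}. {w' \<in> {1..n}. (w' + \<Sum>e) mod K = (w + \<Sum>e) mod K})"
  have f\<Omega>': "finite \<Omega>'" unfolding \<Omega>'_def by (intro finite_SigmaI) auto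
  have sub: "\<Omega> \<subseteq> \<Omega>'" by (auto simp: \<Omega>_def \<Omega>'_def)
  have f\<Omega>: "finite \<Omega>" using sub f\<Omega>' by (rule finite_subset)
  have "clashes n K G = {z \<in> \<Omega>. ?J z \<subseteq> G}" for G by (auto simp: clashes_def \<Omega>_def)
  then have "real (card (clashes n K G)) = (\<Sum>z\<in>\<Omega>. of_bool (?J z \<subseteq> G))" for G
    using f\<Omega> by (simp add: Int_def)
  then have "?E (\<lambda>G. real (card (clashes n K G))) = ?E (\<lambda>G. \<Sum>z\<in>\<Omega>. of_bool (?J z \<subseteq> G))"
    by (simp only:)
  also have "\<dots> = (\<Sum>z\<in>\<Omega>. ?E (\<lambda>G. of_bool (?J z \<subseteq> G)))"
    by (rule Bochner_Integration.integral_sum) (simp add: random_graph_eq_random_subset)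
  also have "\<dots> = (\<Sum>z\<in>\<Omega>. p ^ 5)"
  proof (rule sum.cong[OF refl])
    fix z assume "z \<in> \<Omega>"
    then obtain e w w' where z: "z = (e, w, w')" "e \<in> ?P" "w \<in> {1..n} - e" "w' \<in> {1..n} - e" "w \<noteq> w'"
      by (auto simp: \<Omega>_def)
    have e2: "card e = 2" "finite e" using z by (auto simp: nsets_def)
    have U: "(\<Union>v\<in>{w, w'}. spokes v e) = spokes w e \<union> spokes w' e" by simp
    have "card (spokes w e \<union> spokes w' e) = 4"
      unfolding U[symmetric] using z e2 by (subst card_UN_spokes) auto
    moreover have "e \<notin> spokes w e \<union> spokes w' e" using z by (auto simp: spokes_def)
    ultimately have c: "card (?J z) = 5" using z e2 by (simp add: finite_spokes)
    have "spokes w e \<union> spokes w' e \<subseteq> ?P"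
      unfolding U[symmetric] using z by (intro UN_spokes_subset_pairs) auto
    then have "?J z \<subseteq> ?P" using z by simp
    then have "?E (\<lambda>G. of_bool (?J z \<subseteq> G) * 1) = p ^ card (?J z) * ?E (\<lambda>G. 1)"
      unfolding random_graph_eq_random_subset using assms by (intro expectation_random_subset_plant) auto
    then show "?E (\<lambda>G. of_bool (?J z \<subseteq> G)) = p ^ 5" using c by simp
  qed
  also have "\<dots> = real (card \<Omega>) * p ^ 5" by simp
  also have "\<dots> \<le> real (n choose 2) * (real n * (real n / real K + 1)) * p ^ 5"
  proof (rule mult_right_mono)
    have "real (card \<Omega>) \<le> real (card \<Omega>')" using card_mono[OF f\<Omega>' sub] by simp
    also have "\<dots> = (\<Sum>e\<in>?P. \<Sum>w\<in>{1..n}. real (card {w' \<in> {1..n}. (w' + \<Sum>e) mod K = (w + \<Sum>e) mod K}))"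
      unfolding \<Omega>'_def by (simp add: card_SigmaI)
    also have "\<dots> \<le> (\<Sum>e\<in>?P. \<Sum>w\<in>{1..n}. real n / real K + 1)"
    proof (intro sum_mono)
      fix e :: "nat set" and w
      have "(w + \<Sum>e) mod K < K" using assms by simp
      from card_residue[OF this, of n "\<Sum>e"]
      show "real (card {w' \<in> {1..n}. (w' + \<Sum>e) mod K = (w + \<Sum>e) mod K}) \<le> real n / real K + 1" by linarith
    qed
    also have "\<dots> = real (n choose 2) * (real n * (real n / real K + 1))" by simp
    finally show "real (card \<Omega>) \<le> real (n choose 2) * (real n * (real n / real K + 1))" .
  qed (use assms in simp)
  finally show ?thesis .
qed

context constant_codegree
begin

text \<open>Planting \<open>e\<close>, or both \<open>e\<close> and \<open>f\<close>, leaves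
  survival probabilities near \<open>q\<close> for one edge and \<open>q^2\<close> for two.
  Inclusion-exclusion for the event that neither survives gives \<open>(1 - q)^2\<close> up to three
  errors \<open>\<epsilon>\<close>.\<close>

lemma killed_moments:
  assumes "0 < \<epsilon>"
  shows "\<forall>\<^sub>F n in sequentially.
    (\<forall>e\<in>[{1..n}]\<^bsup>2\<^esup>. p n * (1 - survival (d n / real K) K - \<epsilon>)
       \<le> measure_pmf.expectation (random_graph n (p n)) (\<lambda>G. of_bool (e \<in> killed n K G))) \<and>
    (\<forall>e\<in>[{1..n}]\<^bsup>2\<^esup>. \<forall>f\<in>[{1..n}]\<^bsup>2\<^esup>. e \<noteq> f \<longrightarrow>
       measure_pmf.expectation (random_graph n (p n)) (\<lambda>G. of_bool (e \<in> killed n K G) * of_bool (f \<in> killed n K G))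
       \<le> (p n)\<^sup>2 * ((1 - survival (d n / real K) K)\<^sup>2 + 3 * \<epsilon>))"
  using alive_prob_asympD[OF alive_prob_asymp_all[OF order_refl, of K] assms, of 2]
proof eventually_elim
  case (elim n)
  let ?P = "[{1..n}]\<^bsup>2\<^esup>"
  let ?E = "measure_pmf.expectation (random_graph n (p n)) :: (nat set set \<Rightarrow> real) \<Rightarrow> real"
  define q where "q = survival (d n / real K) K"
  define a where "a J L = alive_prob n (p n) K J K {} L" for J L
  have a: "\<bar>a J L - q ^ card L\<bar> \<le> \<epsilon>" if "J \<subseteq> ?P" "card J \<le> 2" "L \<subseteq> J" for J L
  proof -
    have "\<forall>f\<in>L. late K J K f" using late_if_card_le_2[OF that(1,2)] that(3) by blast
    then have "\<bar>a J L - survival (d n / real K) (Suc K) ^ 0 * q ^ card L\<bar> \<le> \<epsilon>"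
      using elim[rule_format, of J "{}" L] that unfolding a_def q_def by simp
    then show ?thesis by simp
  qed
  have int: "integrable (measure_pmf (random_graph n (p n))) f" for f :: "nat set set \<Rightarrow> real"
    by (simp add: random_graph_eq_random_subset)
  have plant: "?E (\<lambda>G. of_bool (J \<subseteq> G) * f G) = p n ^ card J * ?E (\<lambda>G. f (G \<union> J))" if "J \<subseteq> ?P" for J f
    unfolding random_graph_eq_random_subset using that p by (intro expectation_random_subset_plant) auto
  have aE: "a J L = ?E (\<lambda>G. of_bool (\<forall>f\<in>L. alive n K (G \<union> J) K f))" for J L
    by (simp add: a_def alive_prob_def)
  show ?case
    unfolding q_def[symmetric]
  proof (intro conjI ballI impI)
    fix e assume e: "e \<in> ?P"
    have "?E (\<lambda>G. of_bool (e \<in> killed n K G)) = ?E (\<lambda>G. of_bool ({e} \<subseteq> G) * (1 - of_bool (\<forall>f\<in>{e}. alive n K G K f)))"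
      by (intro arg_cong[where f = ?E] ext) (auto simp: killed_def)
    also have "\<dots> = p n * (1 - a {e} {e})"
      using e by (subst plant) (simp_all add: aE int)
    finally have "?E (\<lambda>G. of_bool (e \<in> killed n K G)) = p n * (1 - a {e} {e})" .
    moreover have "1 - q - \<epsilon> \<le> 1 - a {e} {e}" using a[of "{e}" "{e}"] e by simp
    ultimately show "p n * (1 - q - \<epsilon>) \<le> ?E (\<lambda>G. of_bool (e \<in> killed n K G))"
      using p by (simp add: mult_left_mono)
  next
    fix e f assume ef: "e \<in> ?P" "f \<in> ?P" "e \<noteq> f"
    let ?J = "{e, f}"
    have J: "?J \<subseteq> ?P" "card ?J = 2" using ef by auto
    have "?E (\<lambda>G. of_bool (e \<in> killed n K G) * of_bool (f \<in> killed n K G))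
      = ?E (\<lambda>G. of_bool (?J \<subseteq> G) * (1 - of_bool (\<forall>g\<in>{e}. alive n K G K g) - of_bool (\<forall>g\<in>{f}. alive n K G K g)
          + of_bool (\<forall>g\<in>?J. alive n K G K g)))"
      by (intro arg_cong[where f = ?E] ext) (auto simp: killed_def)
    also have "\<dots> = (p n)\<^sup>2 * (1 - a ?J {e} - a ?J {f} + a ?J ?J)"
      unfolding plant[OF J(1)] J(2) aE by (simp add: int)
    also have "\<dots> \<le> (p n)\<^sup>2 * ((1 - q)\<^sup>2 + 3 * \<epsilon>)"
    proof (rule mult_left_mono)
      have "q - \<epsilon> \<le> a ?J {e}" using a[OF J(1), of "{e}"] J by simp
      moreover have "q - \<epsilon> \<le> a ?J {f}" using a[OF J(1), of "{f}"] J by simp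
      moreover have "a ?J ?J \<le> q\<^sup>2 + \<epsilon>" using a[OF J(1), of ?J] J by simp
      moreover have "(1 - q)\<^sup>2 = 1 - 2 * q + q\<^sup>2" by (simp add: power2_diff)
      ultimately show "1 - a ?J {e} - a ?J {f} + a ?J ?J \<le> (1 - q)\<^sup>2 + 3 * \<epsilon>" by linarith
    qed simp
    finally show "?E (\<lambda>G. of_bool (e \<in> killed n K G) * of_bool (f \<in> killed n K G)) \<le> (p n)\<^sup>2 * ((1 - q)\<^sup>2 + 3 * \<epsilon>)" .
  qed
qed

text \<open>Centring at \<open>m (1 - q)\<close> instead of the mean means that only a lower bound
  on the first moment and an upper bound on the second are required. The diagonal gives
  \<open>m n\<close>; of the five errors \<open>\<epsilon>\<close>, three come from pairs of
  distinct edges and two from the cross term.\<close>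

lemma killed_second_moment:
  fixes K :: nat
  assumes "0 < \<epsilon>"
  defines "m \<equiv> \<lambda>n. real (n choose 2) * p n"
  shows "\<forall>\<^sub>F n in sequentially. measure_pmf.expectation (random_graph n (p n))
      (\<lambda>G. (real (card (killed n K G)) - m n * (1 - survival (d n / real K) K))\<^sup>2)
    \<le> m n + 5 * \<epsilon> * (m n)\<^sup>2"
  using killed_moments[OF assms(1), of K] d_bounds
proof eventually_elim
  case (elim n)
  let ?P = "[{1..n}]\<^bsup>2\<^esup>"
  let ?E = "measure_pmf.expectation (random_graph n (p n)) :: (nat set set \<Rightarrow> real) \<Rightarrow> real"
  define q where "q = survival (d n / real K) K"
  define M where "M = real (n choose 2)"
  let ?D = "\<lambda>e G. of_bool (e \<in> killed n K G) :: real"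
  let ?X = "\<lambda>G. \<Sum>e\<in>?P. ?D e G"
  have q: "0 \<le> q" "q \<le> 1" using elim c by (auto simp: q_def intro: less_imp_le survival_pos survival_le_1)
  have pn: "0 \<le> p n" "p n \<le> 1" using p by auto
  have mM: "m n = M * p n" by (simp add: m_def M_def)
  have M0: "0 \<le> M" by (simp add: M_def)
  have cP: "real (card ?P) = M" by (simp add: M_def)
  have int: "integrable (measure_pmf (random_graph n (p n))) f" for f :: "nat set set \<Rightarrow> real"
    by (simp add: random_graph_eq_random_subset)
  have X: "real (card (killed n K G)) = ?X G" if "G \<subseteq> ?P" for G
  proof -
    have "?P \<inter> killed n K G = killed n K G" using that by (auto simp: killed_def)
    then show ?thesis by simp
  qed
  have D1: "?E (?D e) \<le> p n" if "e \<in> ?P" for e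
  proof -
    have "?E (?D e) \<le> ?E (\<lambda>G. of_bool ({e} \<subseteq> G) * 1)"
      unfolding random_graph_eq_random_subset by (rule expectation_random_subset_mono) (auto simp: killed_def)
    also have "\<dots> = p n" unfolding random_graph_eq_random_subset
      using that pn by (subst expectation_random_subset_plant) auto
    finally show ?thesis .
  qed
  have "m n * (1 - q - \<epsilon>) = (\<Sum>e\<in>?P. p n * (1 - q - \<epsilon>))" by (simp add: mM M_def)
  also have "\<dots> \<le> (\<Sum>e\<in>?P. ?E (?D e))" using elim(1) by (intro sum_mono) (auto simp: q_def)
  also have "\<dots> = ?E ?X" by (rule Bochner_Integration.integral_sum[symmetric]) (rule int)
  finally have EX: "m n * (1 - q - \<epsilon>) \<le> ?E ?X" .
  have "?E (\<lambda>G. (?X G)\<^sup>2) = ?E (\<lambda>G. \<Sum>e\<in>?P. \<Sum>f\<in>?P. ?D e G * ?D f G)"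
    by (simp only: power2_eq_square sum_product)
  also have "\<dots> = (\<Sum>e\<in>?P. \<Sum>f\<in>?P. ?E (\<lambda>G. ?D e G * ?D f G))"
    by (simp only: int Bochner_Integration.integral_sum)
  also have "\<dots> \<le> (\<Sum>e\<in>?P. p n + M * ((p n)\<^sup>2 * ((1 - q)\<^sup>2 + 3 * \<epsilon>)))"
  proof (rule sum_mono)
    fix e assume e: "e \<in> ?P"
    have "(\<Sum>f\<in>?P. ?E (\<lambda>G. ?D e G * ?D f G)) \<le> (\<Sum>f\<in>?P. (if f = e then p n else 0) + (p n)\<^sup>2 * ((1 - q)\<^sup>2 + 3 * \<epsilon>))"
    proof (rule sum_mono)
      fix f assume f: "f \<in> ?P"
      have nn: "0 \<le> (p n)\<^sup>2 * ((1 - q)\<^sup>2 + 3 * \<epsilon>)" using assms(1) by simp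
      show "?E (\<lambda>G. ?D e G * ?D f G) \<le> (if f = e then p n else 0) + (p n)\<^sup>2 * ((1 - q)\<^sup>2 + 3 * \<epsilon>)"
      proof (cases "f = e")
        case True
        then have "(\<lambda>G. ?D e G * ?D f G) = ?D e" by (auto simp: fun_eq_iff)
        then show ?thesis using D1[OF e] True nn by simp
      next
        case False
        then show ?thesis using elim(1) e f unfolding q_def[symmetric] by auto
      qed
    qed
    also have "\<dots> = p n + M * ((p n)\<^sup>2 * ((1 - q)\<^sup>2 + 3 * \<epsilon>))"
      unfolding sum.distrib using e cP by (simp add: sum.delta)
    finally show "(\<Sum>f\<in>?P. ?E (\<lambda>G. ?D e G * ?D f G)) \<le> p n + M * ((p n)\<^sup>2 * ((1 - q)\<^sup>2 + 3 * \<epsilon>))" .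
  qed
  also have "\<dots> = m n + (m n)\<^sup>2 * ((1 - q)\<^sup>2 + 3 * \<epsilon>)"
    unfolding sum_constant cP mM by (simp add: power2_eq_square algebra_simps)
  finally have EX2: "?E (\<lambda>G. (?X G)\<^sup>2) \<le> m n + (m n)\<^sup>2 * ((1 - q)\<^sup>2 + 3 * \<epsilon>)" .
  have m0: "0 \<le> m n" using M0 pn by (simp add: mM)
  have "?E (\<lambda>G. (real (card (killed n K G)) - m n * (1 - q))\<^sup>2) = ?E (\<lambda>G. (?X G)\<^sup>2 - 2 * (m n * (1 - q)) * ?X G + (m n * (1 - q))\<^sup>2)"
    unfolding random_graph_eq_random_subset
    by (rule expectation_random_subset_cong) (simp only: X power2_diff, simp add: algebra_simps)
  also have "\<dots> = ?E (\<lambda>G. (?X G)\<^sup>2) - 2 * (m n * (1 - q)) * ?E ?X + (m n * (1 - q))\<^sup>2"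
  proof -
    have "?E (\<lambda>G. f G - b * g G + b') = ?E f - b * ?E g + b'" for f g b b'
      by (simp add: int)
    then show ?thesis .
  qed
  also have "\<dots> \<le> (m n + (m n)\<^sup>2 * ((1 - q)\<^sup>2 + 3 * \<epsilon>)) - 2 * (m n * (1 - q)) * (m n * (1 - q - \<epsilon>)) + (m n * (1 - q))\<^sup>2"
    using EX EX2 m0 q by (intro add_right_mono diff_mono mult_left_mono) auto
  also have "\<dots> = m n + (m n)\<^sup>2 * (5 * \<epsilon>) - (m n)\<^sup>2 * (2 * \<epsilon> * q)"
    by (simp add: power2_eq_square algebra_simps)
  also have "\<dots> \<le> m n + 5 * \<epsilon> * (m n)\<^sup>2" using q assms(1) by simp
  finally show ?case unfolding q_def .
qed

end

section \<open>The lower bound on the packing number\<close>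

lemma xi_pos: "0 < x \<Longrightarrow> 0 < xi x"
  using powr_less_mono2_neg[of "- 1 / 2" 1 "2 * x + 1"] by (simp add: xi_def)

lemma xi_mono: "0 \<le> x \<Longrightarrow> x \<le> y \<Longrightarrow> xi x \<le> xi y"
  using powr_mono2'[of "- 1 / 2" "2 * x + 1" "2 * y + 1"] by (simp add: xi_def)

context constant_codegree
begin

text \<open>As \<open>p^2 \<le> p\<close>, the expected number of edges is at least
  \<open>n (n - 1) p^2 / 2\<close>, hence at least \<open>d n / 2\<close> times \<open>n\<close>,
  which is linear in \<open>n\<close>.\<close>

lemma expected_edges_at_top: "filterlim (\<lambda>n. real (n choose 2) * p n) at_top sequentially"
proof (rule filterlim_at_top_mono)
  show "filterlim (\<lambda>n. c / 2 * real n) at_top sequentially"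
    using c by (intro filterlim_tendsto_pos_mult_at_top[OF tendsto_const] filterlim_real_sequentially) auto
  show "\<forall>\<^sub>F n in sequentially. c / 2 * real n \<le> real (n choose 2) * p n"
    using d_bounds eventually_ge_at_top[of 2]
  proof eventually_elim
    case (elim n)
    have n: "real (n choose 2) = real n * (real n - 1) / 2"
      using elim(2) by (simp add: choose_two real_of_nat_div of_nat_diff)
    have "c / 2 * real n \<le> (real n - 2) * (p n)\<^sup>2 / 2 * real n"
      using elim d[of n] by (intro mult_right_mono) auto
    also have "\<dots> \<le> (real n - 1) * (p n)\<^sup>2 / 2 * real n"
      by (intro mult_right_mono divide_right_mono) auto
    also have "\<dots> \<le> (real n - 1) * (p n) / 2 * real n"
      using elim(2) p[of n] by (intro mult_right_mono divide_right_mono mult_left_mono) (auto simp: power2_eq_square mult_left_le)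
    finally show ?case by (simp add: n algebra_simps)
  qed
qed

text \<open>Chebyshev's and Markov's inequalities in one step: a pointwise lower bound on the
  indicator of the good event is integrated. Outside the two exceptional events, a deviation of
  killed edges costs at most a third of \<open>\<gamma> m\<close> and the clashes at most
  \<open>\<gamma> m\<close>, together less than \<open>2 \<gamma> m\<close>.\<close>

lemma nu_lower_bound:
  fixes \<gamma> \<delta> :: real
  assumes "0 < \<gamma>" "0 < \<delta>"
  defines "m \<equiv> \<lambda>n. real (n choose 2) * p n"
  shows "\<forall>\<^sub>F n in sequentially. 1 - \<delta> \<le> measure_pmf.prob (random_graph n (p n))
    {G. xi (d n) * m n - 2 * \<gamma> * m n < real (nu G)}"
proof -
  define M where "M = C + 2"
  have M: "0 < M" using c by (simp add: M_def)
  \<comment> \<open>\<open>\<delta>\<close> is split into four quarters: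
    \<open>5 \<epsilon> / \<gamma>^2\<close>, the diagonal term \<open>1 / (\<gamma>^2 m)\<close>,
    and for the clashes \<open>M^2 / (K \<gamma>)\<close> and \<open>M p / \<gamma>\<close>. The
    choices of \<open>\<epsilon>\<close> and \<open>K\<close> settle the first and third, large
    \<open>n\<close> the others.\<close>
  define \<epsilon> where "\<epsilon> = \<gamma>\<^sup>2 * \<delta> / 20"
  have \<epsilon>: "0 < \<epsilon>" using assms by (simp add: \<epsilon>_def)
  obtain K0 :: nat where K0: "4 * M\<^sup>2 / (\<gamma> * \<delta>) \<le> real K0" using real_arch_simple by blast
  define K where "K = Suc K0"
  have K: "0 < K" "4 * M\<^sup>2 / (\<gamma> * \<delta>) \<le> real K" using K0 by (auto simp: K_def)
  have Kb: "M * (M / real K) / \<gamma> \<le> \<delta> / 4"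
    using K assms by (simp add: field_simps power2_eq_square)
  have ev_m: "\<forall>\<^sub>F n in sequentially. 4 / (\<gamma>\<^sup>2 * \<delta>) + 1 \<le> m n"
    using expected_edges_at_top unfolding m_def filterlim_at_top by blast
  have ev_p: "\<forall>\<^sub>F n in sequentially. p n \<le> \<gamma> * \<delta> / (4 * M)"
    using assms M by (intro eventually_p_le) auto
  show ?thesis
    using killed_second_moment[OF \<epsilon>, of K, folded m_def] ev_m ev_p eventually_np2_le d_bounds
  proof eventually_elim
    case (elim n)
    let ?P = "[{1..n}]\<^bsup>2\<^esup>"
    let ?E = "measure_pmf.expectation (random_graph n (p n)) :: (nat set set \<Rightarrow> real) \<Rightarrow> real"
    let ?good = "{G. xi (d n) * m n - 2 * \<gamma> * m n < real (nu G)}"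
    define q where "q = survival (d n / real K) K"
    define X where "X G = real (card (killed n K G))" for G
    define Z where "Z G = real (card (clashes n K G))" for G
    have "0 < 4 / (\<gamma>\<^sup>2 * \<delta>)" using assms by simp
    then have m: "0 < m n" "4 / (\<gamma>\<^sup>2 * \<delta>) \<le> m n" using elim(2) by linarith+
    have pn: "0 \<le> p n" "p n \<le> 1" using p by auto
    have int: "integrable (measure_pmf (random_graph n (p n))) f" for f :: "nat set set \<Rightarrow> real"
      by (simp add: random_graph_eq_random_subset)
    \<comment> \<open>\<open>K\<close> rounds with parameter \<open>d / K\<close> add up to
      \<open>d\<close>, which produces the power in \<open>xi\<close>.\<close>
    have "q \<le> (2 * (d n / real K * real K) + 1) powr (- 1 / 2)"
      unfolding q_def using elim c by (intro survival_le_powr) auto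
    then have xi: "xi (d n) \<le> (1 - q) / 3" using K by (simp add: xi_def)
    have good: "1 - (X G - m n * (1 - q))\<^sup>2 / (\<gamma> * m n)\<^sup>2 - Z G / (\<gamma> * m n) \<le> indicator ?good G"
      if G: "G \<subseteq> ?P" for G
    proof (cases "G \<in> ?good")
      case True
      have "0 \<le> (X G - m n * (1 - q))\<^sup>2 / (\<gamma> * m n)\<^sup>2" "0 \<le> Z G / (\<gamma> * m n)"
        using assms(1) m(1) by (auto simp: Z_def)
      moreover have "indicator ?good G = (1 :: real)" using True by simp
      ultimately show ?thesis by linarith
    next
      case False
      have \<gamma>m: "0 < \<gamma> * m n" using assms(1) m(1) by simp
      have "real (card (killed n K G)) \<le> real (3 * (nu G + card (clashes n K G)))"
        using card_killed_le[OF G] by (rule of_nat_mono)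
      then have XZ: "X G \<le> 3 * real (nu G) + 3 * Z G" by (simp add: X_def Z_def)
      have xim: "xi (d n) * m n \<le> (1 - q) / 3 * m n" using xi m by (intro mult_right_mono) auto
      have "\<gamma> * m n \<le> \<bar>X G - m n * (1 - q)\<bar> \<or> \<gamma> * m n \<le> Z G"
      proof (rule ccontr)
        assume *: "\<not> ?thesis"
        have "m n * (1 - q) - \<gamma> * m n < X G" using * by linarith
        moreover have "m n * (1 - q) = 3 * ((1 - q) / 3 * m n)" by simp
        ultimately have "xi (d n) * m n - 2 * (\<gamma> * m n) < real (nu G)"
          using * XZ xim \<gamma>m by linarith
        then show False using False by (simp add: mult.assoc)
      qed
      moreover have "1 \<le> (X G - m n * (1 - q))\<^sup>2 / (\<gamma> * m n)\<^sup>2" if "\<gamma> * m n \<le> \<bar>X G - m n * (1 - q)\<bar>"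
      proof -
        have "(\<gamma> * m n)\<^sup>2 \<le> \<bar>X G - m n * (1 - q)\<bar>\<^sup>2" using that \<gamma>m by (intro power_mono) auto
        then have "(\<gamma> * m n)\<^sup>2 \<le> (X G - m n * (1 - q))\<^sup>2" by simp
        then show ?thesis using zero_less_power[OF \<gamma>m, of 2] by (subst le_divide_eq_1_pos)
      qed
      moreover have "1 \<le> Z G / (\<gamma> * m n)" if "\<gamma> * m n \<le> Z G"
        using that \<gamma>m by (subst le_divide_eq_1_pos)
      moreover have "0 \<le> (X G - m n * (1 - q))\<^sup>2 / (\<gamma> * m n)\<^sup>2" "0 \<le> Z G / (\<gamma> * m n)"
        using \<gamma>m by (auto simp: Z_def)
      ultimately have "1 \<le> (X G - m n * (1 - q))\<^sup>2 / (\<gamma> * m n)\<^sup>2 + Z G / (\<gamma> * m n)" by linarith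
      moreover have "indicator ?good G = (0 :: real)" using False by simp
      ultimately show ?thesis by linarith
    qed
    have v1: "?E (\<lambda>G. (X G - m n * (1 - q))\<^sup>2) / (\<gamma> * m n)\<^sup>2 \<le> \<delta> / 2"
    proof -
      have "?E (\<lambda>G. (X G - m n * (1 - q))\<^sup>2) / (\<gamma> * m n)\<^sup>2 \<le> (m n + 5 * \<epsilon> * (m n)\<^sup>2) / (\<gamma> * m n)\<^sup>2"
        using elim(1) by (intro divide_right_mono) (auto simp: X_def q_def m_def)
      also have "\<dots> = 1 / (\<gamma>\<^sup>2 * m n) + 5 * \<epsilon> / \<gamma>\<^sup>2"
        using m(1) assms(1) by (simp add: add_divide_distrib power_mult_distrib) (simp add: power2_eq_square)
      also have "5 * \<epsilon> / \<gamma>\<^sup>2 = \<delta> / 4" using assms by (simp add: \<epsilon>_def)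
      also have "1 / (\<gamma>\<^sup>2 * m n) \<le> \<delta> / 4"
      proof -
        have "4 \<le> m n * (\<gamma>\<^sup>2 * \<delta>)" using m(2) assms(1,2) by (simp add: pos_divide_le_eq)
        then show ?thesis using m(1) assms(1,2) by (simp add: field_simps)
      qed
      finally show ?thesis by simp
    qed
    have v2: "?E Z / (\<gamma> * m n) \<le> \<delta> / 2"
    proof -
      have np: "0 \<le> real n * (p n)\<^sup>2" "real n * (p n)\<^sup>2 \<le> M" using elim by (auto simp: M_def)
      have p2: "(p n)\<^sup>2 \<le> p n" using pn by (simp add: power2_eq_square mult_left_le)
      have "?E Z \<le> real (n choose 2) * (real n * (real n / real K + 1)) * p n ^ 5"
        unfolding Z_def using K pn by (intro expectation_clashes_le) auto
      \<comment> \<open>Of the five factors \<open>p\<close>, the one of the common edge completes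
        \<open>m n\<close>, and each apex takes two.\<close>
      also have "\<dots> = m n * ((real n * (p n)\<^sup>2) * (real n * (p n)\<^sup>2 / real K + (p n)\<^sup>2))"
        by (simp add: m_def power2_eq_square power_numeral_reduce algebra_simps)
      also have "\<dots> \<le> m n * (M * (M / real K + p n))"
        using np p2 m(1) M by (intro mult_left_mono mult_mono add_mono divide_right_mono) auto
      finally have "?E Z / (\<gamma> * m n) \<le> m n * (M * (M / real K + p n)) / (\<gamma> * m n)"
        using m(1) assms(1) by (intro divide_right_mono) auto
      also have "\<dots> = M * (M / real K) / \<gamma> + M * p n / \<gamma>"
        using m(1) assms(1) by (simp add: field_simps)
      also have "M * p n / \<gamma> \<le> M * (\<gamma> * \<delta> / (4 * M)) / \<gamma>"
        using elim M assms(1) by (intro divide_right_mono mult_left_mono) auto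
      also have "\<dots> = \<delta> / 4" using M assms(1) by simp
      finally show ?thesis using Kb by linarith
    qed
    have "1 - \<delta> \<le> 1 - ?E (\<lambda>G. (X G - m n * (1 - q))\<^sup>2) / (\<gamma> * m n)\<^sup>2 - ?E Z / (\<gamma> * m n)"
      using v1 v2 by linarith
    also have "\<dots> = ?E (\<lambda>G. 1 - (X G - m n * (1 - q))\<^sup>2 / (\<gamma> * m n)\<^sup>2 - Z G / (\<gamma> * m n))"
      by (simp add: int)
    also have "\<dots> \<le> ?E (indicator ?good)"
      unfolding random_graph_eq_random_subset using good
      by (intro expectation_random_subset_mono) auto
    also have "\<dots> = measure_pmf.prob (random_graph n (p n)) ?good" by simp
    finally show ?case .
  qed
qed

end

theorem theorem1p4:
  fixes p m d :: "nat \<Rightarrow> real" and c C \<epsilon> :: real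
  assumes p: "\<And>n. 0 \<le> p n \<and> p n \<le> 1"
    and m: "\<And>n. m n = real (n choose 2) * p n"
    and d: "\<And>n. d n = (real n - 2) * (p n)\<^sup>2"
    and c: "0 < c" "c \<le> C"
    and d_Theta: "\<forall>\<^sub>F n in sequentially. c \<le> d n \<and> d n \<le> C"
    and \<epsilon>: "0 < \<epsilon>"
  shows "(\<lambda>n. measure_pmf.prob (random_graph n (p n))
            {E. real (nu E) > (1 - \<epsilon>) * xi (d n) * m n}) \<longlonglongrightarrow> 1"
proof -
  interpret constant_codegree p d c C
    using p d c d_Theta by unfold_locales auto
  \<comment> \<open>The additive loss \<open>2 \<gamma> m\<close> must not exceed
    \<open>\<epsilon>\<close> times \<open>xi (d n) * m n\<close>. As \<open>xi\<close> is
    increasing and \<open>c \<le> d n\<close> eventually, its value at \<open>c\<close> yields one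
    constant for all large \<open>n\<close>.\<close>
  define \<gamma> where "\<gamma> = \<epsilon> * xi c / 2"
  have \<gamma>: "0 < \<gamma>" using \<epsilon> c xi_pos by (simp add: \<gamma>_def)
  show ?thesis
  proof (rule order_tendstoI)
    fix a :: real assume "a < 1"
    then have \<delta>: "0 < (1 - a) / 2" by simp
    show "\<forall>\<^sub>F n in sequentially. a < measure_pmf.prob (random_graph n (p n))
        {E. real (nu E) > (1 - \<epsilon>) * xi (d n) * m n}"
      using nu_lower_bound[OF \<gamma> \<delta>, folded m] d_bounds
    proof eventually_elim
      case (elim n)
      have "0 \<le> m n" using p by (simp add: m)
      have "xi c \<le> xi (d n)" using elim c by (intro xi_mono) auto
      then have "\<epsilon> * xi c * m n \<le> \<epsilon> * xi (d n) * m n"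
        using \<epsilon> \<open>0 \<le> m n\<close> by (intro mult_right_mono mult_left_mono) auto
      then have le: "(1 - \<epsilon>) * xi (d n) * m n \<le> xi (d n) * m n - 2 * \<gamma> * m n"
        by (simp add: \<gamma>_def algebra_simps)
      have "a < 1 - (1 - a) / 2" using \<open>a < 1\<close> by (simp add: field_simps)
      also have "\<dots> \<le> measure_pmf.prob (random_graph n (p n)) {E. xi (d n) * m n - 2 * \<gamma> * m n < real (nu E)}"
        using elim by simp
      also have "\<dots> \<le> measure_pmf.prob (random_graph n (p n)) {E. real (nu E) > (1 - \<epsilon>) * xi (d n) * m n}"
        using le by (intro measure_pmf.finite_measure_mono) auto
      finally show ?case .
    qed
  next
    fix a :: real assume "1 < a"
    then show "\<forall>\<^sub>F n in sequentially. measure_pmf.prob (random_graph n (p n))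
        {E. real (nu E) > (1 - \<epsilon>) * xi (d n) * m n} < a"
      by (intro always_eventually allI le_less_trans[OF measure_pmf.prob_le_1])
  qed
qed

end
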